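(* Let $c_0>0$. There is a constant $C\ge1$ depending on $c_0$ such that, for every sequence $(\beta_n)_{n\ge1}$ of positive numbers with $\beta_n\ge c_0\log n$ for all large $n$, $$\limsup_{n\to\infty}\max_{1\le j\le n}\|\ell_j\|_\infty\le C\qquad\text{almost surely,}$$ where, for each $n$, $\ell_1,\dots,\ell_n$ are the weighted Lagrange polynomials associated with the random configuration $\{x_j\}_{j=1}^n$ drawn from $\mathbf P_n^{\beta_n}$.
   Context: For $\beta>0$ and $n\ge1$, $\mathbf P_n^\beta$ is the probability measure on $\mathbb R^n$ with density $$p_n^\beta(x_1,\dots,x_n)=\frac1{Z_{\beta,n}}\prod_{k<j}|x_k-x_j|^\beta\, e^{-n\frac\beta2\sum_{j=1}^n\frac12x_j^2},$$ where $Z_{\beta,n}$ is the normalizing constant. "Almost surely" refers to the product measure $\mathbf P=\prod_{n=1}^\infty\mathbf P_n^{\beta_n}$ on sequences of configurations. For a configuration $\{x_j\}_{j=1}^n$ of distinct real points and $1\le j\le n$, $$\ell_j(x)=\Big(\prod_{k\ne j}\frac{x-x_k}{x_j-x_k}\Big)e^{-\frac14n(x^2-x_j^2)},\qquad x\in\mathbb R.$$ $\|\cdot\|_\infty$ is the sup norm on $\mathbb R$. *)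

theory Defs
  imports "HOL-Probability.Probability"
begin

text \<open>
  A point of \<open>\<real>\<^sup>n\<close> is a function on the index set \<open>{1..n}\<close>, so that the dimension can vary within
  one statement; Lebesgue measure on \<open>\<real>\<^sup>n\<close> is the product measure \<open>lebesgue_Rn n\<close>.
\<close>

abbreviation lebesgue_Rn :: "nat \<Rightarrow> (nat \<Rightarrow> real) measure" where
  "lebesgue_Rn n \<equiv> Pi\<^sub>M {1..n} (\<lambda>_. lborel)"

definition beta_weight :: "real \<Rightarrow> nat \<Rightarrow> (nat \<Rightarrow> real) \<Rightarrow> real" where
  "beta_weight \<beta> n x =
     (\<Prod>j\<in>{1..n}. \<Prod>k\<in>{1..<j}. \<bar>x k - x j\<bar> powr \<beta>)
       * exp (- real n * (\<beta> / 2) * (\<Sum>j\<in>{1..n}. (1 / 2) * (x j)\<^sup>2))"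

definition beta_Z :: "real \<Rightarrow> nat \<Rightarrow> real" where
  "beta_Z \<beta> n = (\<integral>x. beta_weight \<beta> n x \<partial>lebesgue_Rn n)"

definition beta_ensemble :: "real \<Rightarrow> nat \<Rightarrow> (nat \<Rightarrow> real) measure" where
  "beta_ensemble \<beta> n =
     density (lebesgue_Rn n) (\<lambda>x. ennreal (beta_weight \<beta> n x / beta_Z \<beta> n))"

definition weighted_lagrange :: "nat \<Rightarrow> (nat \<Rightarrow> real) \<Rightarrow> nat \<Rightarrow> real \<Rightarrow> real" where
  "weighted_lagrange n xs j t =
     (\<Prod>k\<in>{1..n} - {j}. (t - xs k) / (xs j - xs k))
       * exp (- (1 / 4) * real n * (t\<^sup>2 - (xs j)\<^sup>2))"

text \<open>
  The sup norm is taken in the extended reals, so that it is \<open>\<infinity>\<close> (rather than an unspecified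
  real) on unbounded functions.
\<close>

definition sup_norm :: "(real \<Rightarrow> real) \<Rightarrow> ereal" where
  "sup_norm f = (SUP t. ereal \<bar>f t\<bar>)"

end

(*
  Let J_j be the integral of |l_j(t)|^beta over t. Since |l_j(t)|^beta times the density at x equals
  the density at the configuration in which x_j is moved to t, Fubini gives E[f(x_j) J_j] <= integral
  of f for every f >= 0. With f the indicator of [-6n, 6n], Markov's inequality and a union bound over
  j give J_j <= n^4 for all j outside an event of probability O(n^-2); that all points lie in
  [-6n, 6n] has overwhelming probability, because rescaling the configuration by sqrt 2 bounds an
  exponential moment of the sum of the x_k^2. By Borel-Cantelli, almost surely J_j <= n^4 for all
  large n and all j.

  Deterministically, |l_j| stays above M/16, M its supremum, on an interval of length 1/(3 n^2): this
  is a Markov type inequality for real-rooted polynomials. So (M/16)^beta <= 3 n^6, and since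
  beta >= c0 log n this bounds M by 16 exp(8/c0).
*)

theory Submission
  imports Defs
begin

section \<open>A Markov inequality for real-rooted polynomials\<close>

text \<open>Under the assumption on beta_n, a factor n^a raised to the power 1 / beta_n is at most
  exp(a / c0). Polynomial losses in n are therefore harmless wherever they sit under that power, and
  the moment, union and Markov bounds may all be crude; only the drop from M to M / 16 stays outside
  the power, so it has to be an absolute constant. The test function f has to be integrable because
  the old position of x_j is integrated against Lebesgue measure: f = 1 gives an infinite bound.
  Hence the points must first be confined to an interval of polynomial length. The obstacle in the
  deterministic part is that zeros may lie close to the near-maximum t0, so the logarithmic
  derivative there is not controlled. Multiplying the values at t0 + s and t0 - s removes the odd
  terms and leaves a polynomial in s^2 whose derivative at 0 is minus the sum of 1 / (t0 - x_k)^2.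
  As all zeros are real, these terms have one sign, so a bound on this single derivative controls
  every factor at once.\<close>

lemma alternating_binomial_sum_Suc:
  fixes f :: "nat \<Rightarrow> real"
  shows "(\<Sum>i\<le>Suc N. (-1) ^ i * real (Suc N choose i) * f i)
       = (\<Sum>i\<le>N. (-1) ^ i * real (N choose i) * (f i - f (Suc i)))"
proof -
  have "(\<Sum>i\<le>Suc N. (-1) ^ i * real (Suc N choose i) * f i)
      = f 0 + (\<Sum>i\<le>N. (-1) ^ Suc i * real (Suc N choose Suc i) * f (Suc i))"
    by (subst sum.atMost_Suc_shift) simp
  also have "\<dots> = f 0 - (\<Sum>i\<le>N. (-1) ^ i * real (N choose Suc i) * f (Suc i))
      - (\<Sum>i\<le>N. (-1) ^ i * real (N choose i) * f (Suc i))"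
    by (simp add: algebra_simps sum.distrib sum_negf sum_subtractf)
  also have "f 0 - (\<Sum>i\<le>N. (-1) ^ i * real (N choose Suc i) * f (Suc i))
      = (\<Sum>i\<le>Suc N. (-1) ^ i * real (N choose i) * f i)"
    by (subst sum.atMost_Suc_shift) (simp add: sum_negf)
  also have "\<dots> = (\<Sum>i\<le>N. (-1) ^ i * real (N choose i) * f i)"
    by simp
  finally show ?thesis
    by (simp add: algebra_simps sum_subtractf)
qed

text \<open>A shift of the argument preserves degree and leading coefficient, so the difference
  loses its top term. The alternative \<open>= 0\<close> is there because the zero polynomial has
  degree 0, which is not below \<open>N\<close> when \<open>N = 0\<close>.\<close>

lemma degree_poly_minus_shift:
  fixes p :: "real poly"
  assumes "degree p < Suc N"
  shows "p - pcompose p [:1, 1:] = 0 \<or> degree (p - pcompose p [:1, 1:]) < N"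
proof (cases "degree p = 0")
  case True
  then obtain c where "p = [:c:]" by (rule degree_eq_zeroE)
  then show ?thesis by simp
next
  case False
  have deg: "degree (pcompose p [:1, 1:]) = degree p"
    by (simp add: degree_pcompose)
  have "lead_coeff (pcompose p [:1, 1:]) = lead_coeff p"
    by (subst lead_coeff_comp) auto
  then have "coeff (p - pcompose p [:1, 1:]) (degree p) = 0"
    by (simp add: deg)
  moreover have "degree (p - pcompose p [:1, 1:]) \<le> degree p"
    by (metis deg degree_diff_le order_refl)
  ultimately have "p - pcompose p [:1, 1:] = 0 \<or> degree (p - pcompose p [:1, 1:]) < degree p"
    by (metis le_neq_implies_less leading_coeff_0_iff)
  with assms show ?thesis by linarith
qed

text \<open>Up to sign this is the \<open>N\<close>-th finite difference of \<open>p\<close> at 0;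
  each difference lowers the degree. It expresses the value of \<open>p\<close> at one grid node
  through its values at the others.\<close>

lemma alternating_binomial_sum_poly:
  fixes p :: "real poly"
  assumes "p = 0 \<or> degree p < N"
  shows "(\<Sum>i\<le>N. (-1) ^ i * real (N choose i) * poly p (real i)) = 0"
  using assms
proof (induction N arbitrary: p)
  case 0
  then show ?case by simp
next
  case (Suc N)
  let ?q = "p - pcompose p [:1, 1:]"
  have "?q = 0 \<or> degree ?q < N"
    using Suc.prems degree_poly_minus_shift by (cases "p = 0") auto
  then have "(\<Sum>i\<le>N. (-1) ^ i * real (N choose i) * poly ?q (real i)) = 0"
    by (rule Suc.IH)
  then show ?case
    by (subst alternating_binomial_sum_Suc) (simp add: poly_pcompose add.commute)
qed

text \<open>\<open>G\<close> is the quotient (R - 1) / z of the product R, provided as a polynomial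
  so that it can be evaluated at z = 0, where it gives the derivative of R.\<close>

lemma prod_one_minus_poly:
  fixes u :: "'a \<Rightarrow> real"
  assumes "finite S"
  obtains G where "G = 0 \<or> degree G < card S"
    and "\<And>z. (\<Prod>k\<in>S. 1 - z * u k) = 1 + z * poly G z"
    and "poly G 0 = - (\<Sum>k\<in>S. u k)"
  using assms
proof (induction S arbitrary: thesis rule: finite_induct)
  case empty
  then show ?case by (metis add.right_neutral mult_zero_right poly_0 prod.empty sum.empty neg_0_equal_iff_equal)
next
  case (insert a S)
  obtain G where G: "G = 0 \<or> degree G < card S"
    "\<And>z. (\<Prod>k\<in>S. 1 - z * u k) = 1 + z * poly G z" "poly G 0 = - (\<Sum>k\<in>S. u k)"
    using insert.IH by blast
  \<comment> \<open>Read off from (1 + z G) (1 - z u_a) = 1 + z (G - u_a - z u_a G).\<close>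
  let ?H = "G - [:u a:] - [:0, u a:] * G"
  have "degree ?H < card (insert a S)"
  proof (cases "G = 0")
    case True
    then show ?thesis using insert by simp
  next
    case False
    with G(1) have "degree G < card S" by simp
    moreover have "degree ([:0, u a:] * G) \<le> 1 + degree G"
      by (rule order_trans[OF degree_mult_le]) auto
    ultimately have "degree ?H \<le> card S"
      by (intro degree_diff_le) auto
    then show ?thesis using insert by simp
  qed
  moreover have "(\<Prod>k\<in>insert a S. 1 - z * u k) = 1 + z * poly ?H z" for z
    using insert by (simp add: G(2) algebra_simps)
  moreover have "poly ?H 0 = - (\<Sum>k\<in>insert a S. u k)"
    using insert by (simp add: G(3))
  ultimately show ?case using insert.prems by blast
qed

text \<open>
  The binomial identity is applied to the even polynomial
  \<open>s \<mapsto> (R (s\<^sup>2) - 1) / s\<^sup>2\<close> on an equispaced grid centred at \<open>0\<close>, where \<open>R z = (\<Prod>k\<in>S. 1 - z * u k)\<close>;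
  its value at the centre is the derivative of \<open>R\<close> at \<open>0\<close>, and the central binomial coefficient dominates.
\<close>

lemma sum_le_of_prod_one_minus_bounded:
  fixes u :: "'a \<Rightarrow> real"
  assumes S: "finite S" and "Z > 0"
    and bd: "\<And>z. 0 \<le> z \<Longrightarrow> z \<le> Z \<Longrightarrow> \<bar>\<Prod>k\<in>S. 1 - z * u k\<bar> \<le> B"
  shows "(\<Sum>k\<in>S. u k) \<le> 2 * (B + 1) * real (card S) ^ 3 / Z"
proof (cases "S = {}")
  case True
  then show ?thesis by simp
next
  case False
  define d where "d = card S"
  have d: "d > 0" using False S by (simp add: d_def card_gt_0_iff)
  \<comment> \<open>The squared step of a grid of 2 d + 1 nodes centred at index \<open>d\<close>.
    Both end nodes then have square exactly \<open>Z\<close>, so \<open>bd\<close> covers the whole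
    grid; the step itself never occurs, only its square.\<close>
  define h2 where "h2 = Z / real d ^ 2"
  have h2: "h2 > 0" using d \<open>Z > 0\<close> by (simp add: h2_def)
  obtain G where G: "G = 0 \<or> degree G < d"
    "\<And>z. (\<Prod>k\<in>S. 1 - z * u k) = 1 + z * poly G z" "poly G 0 = - (\<Sum>k\<in>S. u k)"
    using prod_one_minus_poly[OF S, of u] unfolding d_def by blast
  define q where "q = pcompose G ([:h2:] * [:- real d, 1:] ^ 2)"
  have q: "poly q x = poly G (h2 * (x - real d)\<^sup>2)" for x
    by (simp add: q_def poly_pcompose poly_power)
  have "degree ([:h2:] * [:- real d, 1:] ^ 2) = 2"
    using h2 by (simp add: degree_power_eq)
  then have "degree q = degree G * 2"
    by (simp only: q_def degree_pcompose)
  \<comment> \<open>The degree is at most 2 (d - 1), below the order 2 d of the difference over 2 d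
    + 1 nodes.\<close>
  then have "q = 0 \<or> degree q < 2 * d"
    using G(1) by (auto simp: q_def)
  then have "(\<Sum>i\<le>2*d. (-1) ^ i * real ((2*d) choose i) * poly q (real i)) = 0"
    by (rule alternating_binomial_sum_poly)
  also have "(\<Sum>i\<le>2*d. (-1) ^ i * real ((2*d) choose i) * poly q (real i))
     = (-1) ^ d * real ((2*d) choose d) * poly G 0
       + (\<Sum>i\<in>{..2*d} - {d}. (-1) ^ i * real ((2*d) choose i) * poly q (real i))"
    by (subst sum.remove[of _ d]) (auto simp: q)
  finally have eq: "(-1) ^ d * real ((2*d) choose d) * poly G 0
      = - (\<Sum>i\<in>{..2*d} - {d}. (-1) ^ i * real ((2*d) choose i) * poly q (real i))"
    by linarith
  \<comment> \<open>Passing from R to \<open>G\<close> divides by z, so the bound is worst at the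
    two nodes next to the centre, where z = \<open>h2\<close>. The centre is the node isolated in
    \<open>eq\<close>.\<close>
  have B: "\<bar>poly G z\<bar> \<le> (B + 1) / h2" if "h2 \<le> z" "z \<le> Z" for z
  proof -
    have "\<bar>1 + z * poly G z\<bar> \<le> B"
      using bd[of z] that h2 by (simp add: G(2))
    then have "\<bar>z * poly G z\<bar> \<le> B + 1" by linarith
    then have "z * \<bar>poly G z\<bar> \<le> B + 1"
      using that h2 by (simp add: abs_mult)
    moreover have "h2 * \<bar>poly G z\<bar> \<le> z * \<bar>poly G z\<bar>"
      using that by (intro mult_right_mono) auto
    ultimately show ?thesis using h2 by (simp add: field_simps)
  qed
  have qB: "\<bar>poly q (real i)\<bar> \<le> (B + 1) / h2" if "i \<in> {..2*d} - {d}" for i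
  proof -
    have "1 \<le> \<bar>real i - real d\<bar>" "\<bar>real i - real d\<bar> \<le> real d"
      using that by auto
    then have "1 \<le> (real i - real d)\<^sup>2" "(real i - real d)\<^sup>2 \<le> (real d)\<^sup>2"
      by (metis abs_ge_zero abs_le_square_iff abs_of_nonneg of_nat_0_le_iff power2_abs power_mono one_power2 abs_one)+
    then have "h2 * 1 \<le> h2 * (real i - real d)\<^sup>2" "h2 * (real i - real d)\<^sup>2 \<le> h2 * (real d)\<^sup>2"
      using h2 by auto
    moreover have "h2 * (real d)\<^sup>2 = Z" using d by (simp add: h2_def)
    ultimately show ?thesis unfolding q by (intro B) auto
  qed
  have B0: "(B + 1) / h2 \<ge> 0"
    using bd[of 0] \<open>Z > 0\<close> h2 by (simp add: divide_nonneg_pos)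
  have "real ((2*d) choose d) * \<bar>poly G 0\<bar>
      = \<bar>\<Sum>i\<in>{..2*d} - {d}. (-1) ^ i * real ((2*d) choose i) * poly q (real i)\<bar>"
    using arg_cong[OF eq, of abs] by (simp add: abs_mult power_abs)
  also have "\<dots> \<le> (\<Sum>i\<in>{..2*d} - {d}. real ((2*d) choose d) * ((B + 1) / h2))"
  proof (rule order_trans[OF sum_abs], rule sum_mono)
    fix i assume i: "i \<in> {..2*d} - {d}"
    have "\<bar>(-1) ^ i * real ((2*d) choose i) * poly q (real i)\<bar> = real ((2*d) choose i) * \<bar>poly q (real i)\<bar>"
      by (simp add: abs_mult power_abs)
    also have "\<dots> \<le> real ((2*d) choose d) * ((B + 1) / h2)"
      using qB[OF i] by (intro mult_mono of_nat_mono binomial_maximum') auto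
    finally show "\<bar>(-1) ^ i * real ((2*d) choose i) * poly q (real i)\<bar> \<le> real ((2*d) choose d) * ((B + 1) / h2)" .
  qed
  also have "\<dots> = real ((2*d) choose d) * (2 * real d * ((B + 1) / h2))"
    by simp
  finally have "\<bar>poly G 0\<bar> \<le> 2 * real d * ((B + 1) / h2)"
    by (subst (asm) mult_le_cancel_left_pos) auto
  moreover have "2 * real d * ((B + 1) / h2) = 2 * (B + 1) * real d ^ 3 / Z"
    using d \<open>Z > 0\<close> by (simp add: h2_def field_simps power2_eq_square power3_eq_cube)
  ultimately show ?thesis using G(3) unfolding d_def by linarith
qed


section \<open>Weighted polynomials near their maximum\<close>

text \<open>Form of a Lagrange polynomial with its normalization hidden in \<open>c\<close>. The
  weight parameter \<open>n\<close> is kept apart from \<open>card S\<close> because l_j has only n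
  - 1 zeros.\<close>

definition weighted_poly :: "nat \<Rightarrow> real \<Rightarrow> 'a set \<Rightarrow> ('a \<Rightarrow> real) \<Rightarrow> real \<Rightarrow> real" where
  "weighted_poly n c S x t = c * (\<Prod>k\<in>S. t - x k) * exp (- (real n / 4) * t\<^sup>2)"

text \<open>
  With \<open>u k = 1 / (t0 - x k)\<^sup>2\<close> one has
  \<open>f (t0 + s) * f (t0 - s) = (f t0)\<^sup>2 * (\<Prod>k. 1 - s\<^sup>2 * u k) * exp (- n * s\<^sup>2 / 2)\<close>.
  Near-maximality of \<open>\<bar>f t0\<bar>\<close> bounds the product from above, so the Markov inequality bounds
  \<open>\<Sum>k. u k\<close>; this in turn bounds the product from below for small \<open>s\<close>.
\<close>

lemma weighted_poly_flat_near_max: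
  fixes n :: nat and c :: real and S :: "'a set" and x :: "'a \<Rightarrow> real"
  defines "f \<equiv> weighted_poly n c S x"
  assumes S: "finite S" "card S \<le> n" and n: "n \<ge> 1"
    and M: "M > 0" and bd: "\<And>t. \<bar>f t\<bar> \<le> M" and t0: "\<bar>f t0\<bar> \<ge> M / 2"
    and s: "\<bar>s\<bar> \<le> 1 / (6 * real n ^ 2)"
  shows "\<bar>f (t0 + s)\<bar> \<ge> M / 16"
proof -
  define u where "u k = 1 / (t0 - x k)\<^sup>2" for k
  define F where "F = \<bar>f t0\<bar>"
  have F: "F > 0" "F \<ge> M / 2" using M t0 by (auto simp: F_def)
  then have "(\<Prod>k\<in>S. t0 - x k) \<noteq> 0" by (auto simp: f_def weighted_poly_def F_def)
  then have nz: "t0 - x k \<noteq> 0" if "k \<in> S" for k using S that by auto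
  have u0: "u k \<ge> 0" for k by (simp add: u_def)
  have pm: "\<bar>f (t0 + r)\<bar> * \<bar>f (t0 - r)\<bar> = F\<^sup>2 * \<bar>\<Prod>k\<in>S. 1 - r\<^sup>2 * u k\<bar> * exp (- (real n * r\<^sup>2 / 2))" for r
  proof -
    have "(\<Prod>k\<in>S. t0 + r - x k) * (\<Prod>k\<in>S. t0 - r - x k)
        = (\<Prod>k\<in>S. (t0 - x k) * (t0 - x k) * (1 - r\<^sup>2 * u k))"
      unfolding prod.distrib[symmetric]
    proof (rule prod.cong[OF refl])
      fix k assume "k \<in> S"
      with nz have "(t0 - x k)\<^sup>2 * (r\<^sup>2 * u k) = r\<^sup>2"
        by (simp add: u_def)
      then have "(t0 - x k) * (t0 - x k) * (1 - r\<^sup>2 * u k) = (t0 - x k)\<^sup>2 - r\<^sup>2"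
        by (simp add: power2_eq_square right_diff_distrib)
      then show "(t0 + r - x k) * (t0 - r - x k) = (t0 - x k) * (t0 - x k) * (1 - r\<^sup>2 * u k)"
        by (simp add: power2_eq_square algebra_simps)
    qed
    also have "\<dots> = (\<Prod>k\<in>S. t0 - x k)\<^sup>2 * (\<Prod>k\<in>S. 1 - r\<^sup>2 * u k)"
      by (simp add: prod.distrib power2_eq_square)
    finally have P: "(\<Prod>k\<in>S. t0 + r - x k) * (\<Prod>k\<in>S. t0 - r - x k)
      = (\<Prod>k\<in>S. t0 - x k)\<^sup>2 * (\<Prod>k\<in>S. 1 - r\<^sup>2 * u k)" .
    have E: "exp (- (real n / 4) * (t0 + r)\<^sup>2) * exp (- (real n / 4) * (t0 - r)\<^sup>2)
      = (exp (- (real n / 4) * t0\<^sup>2))\<^sup>2 * exp (- (real n * r\<^sup>2 / 2))"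
      unfolding exp_double[symmetric] mult_exp_exp
      by (rule arg_cong[of _ _ exp]) (simp add: power2_eq_square algebra_simps)
    have "f (t0 + r) * f (t0 - r) = c\<^sup>2 * ((\<Prod>k\<in>S. t0 + r - x k) * (\<Prod>k\<in>S. t0 - r - x k))
      * (exp (- (real n / 4) * (t0 + r)\<^sup>2) * exp (- (real n / 4) * (t0 - r)\<^sup>2))"
      by (simp add: f_def weighted_poly_def power2_eq_square)
    also have "\<dots> = (f t0)\<^sup>2 * (\<Prod>k\<in>S. 1 - r\<^sup>2 * u k) * exp (- (real n * r\<^sup>2 / 2))"
      unfolding P E by (simp add: f_def weighted_poly_def power_mult_distrib)
    finally have "f (t0 + r) * f (t0 - r)
      = (f t0)\<^sup>2 * (\<Prod>k\<in>S. 1 - r\<^sup>2 * u k) * exp (- (real n * r\<^sup>2 / 2))" .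
    from arg_cong[OF this, of abs] show ?thesis
      by (simp add: abs_mult F_def)
  qed
  \<comment> \<open>Near-maximality contributes (M / F)^2 \<le> 4. Stopping at z = 1 / n keeps the
    inverse weight below exp(1 / 2) \<le> 7 / 4, hence the constant 7.\<close>
  have up: "\<bar>\<Prod>k\<in>S. 1 - z * u k\<bar> \<le> 7" if z: "0 \<le> z" "z \<le> 1 / real n" for z
  proof -
    have "F\<^sup>2 * (\<bar>\<Prod>k\<in>S. 1 - z * u k\<bar> * exp (- (real n * z / 2)))
        = \<bar>f (t0 + sqrt z)\<bar> * \<bar>f (t0 - sqrt z)\<bar>"
      using z by (simp add: pm mult.assoc)
    also have "\<dots> \<le> M * M"
      using bd M by (intro mult_mono) auto
    also have "\<dots> \<le> (2 * F) * (2 * F)" using F M by (intro mult_mono) auto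
    also have "\<dots> = F\<^sup>2 * 4" by (simp add: power2_eq_square)
    finally have "F\<^sup>2 * (\<bar>\<Prod>k\<in>S. 1 - z * u k\<bar> * exp (- (real n * z / 2))) \<le> F\<^sup>2 * 4" .
    then have "\<bar>\<Prod>k\<in>S. 1 - z * u k\<bar> * exp (- (real n * z / 2)) \<le> 4"
      using F by (simp add: mult_le_cancel_left_pos)
    then have "\<bar>\<Prod>k\<in>S. 1 - z * u k\<bar> \<le> 4 * exp (real n * z / 2)"
      by (simp add: exp_minus field_simps)
    also have "exp (real n * z / 2) \<le> exp (1 / 2)"
      using z n by (simp add: field_simps)
    also have "exp (1 / 2 :: real) \<le> 7 / 4"
      using exp_bound[of "1/2 :: real"] by (simp add: power2_eq_square)
    finally show ?thesis by simp
  qed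
  have "(\<Sum>k\<in>S. u k) \<le> 2 * (7 + 1) * real (card S) ^ 3 / (1 / real n)"
    using S n up by (intro sum_le_of_prod_one_minus_bounded) auto
  also have "\<dots> \<le> 16 * real n ^ 3 * real n"
    using S by (simp add: power_mono mult_right_mono)
  finally have U: "(\<Sum>k\<in>S. u k) \<le> 16 * real n ^ 4" by (simp add: power_numeral_reduce)
  \<comment> \<open>The window is chosen against \<open>U\<close>: the product of the two bounds is
    16 / 36, below 1 / 2.\<close>
  have s2: "s\<^sup>2 \<le> 1 / (36 * real n ^ 4)"
    using power_mono[OF s, of 2] by (simp add: power_divide power_mult_distrib flip: power_mult)
  have "s\<^sup>2 * (\<Sum>k\<in>S. u k) \<le> 1 / (36 * real n ^ 4) * (16 * real n ^ 4)"
    using s2 U u0 by (intro mult_mono) (auto intro: sum_nonneg)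
  also have "\<dots> \<le> 1 / 2" using n by simp
  finally have half: "(\<Sum>k\<in>S. s\<^sup>2 * u k) \<le> 1 / 2" by (simp add: sum_distrib_left)
  have "1 - (\<Sum>k\<in>S. s\<^sup>2 * u k) \<le> (\<Prod>k\<in>S. 1 - s\<^sup>2 * u k)"
  proof (rule Weierstrass_prod_ineq)
    fix k assume "k \<in> S"
    then have "s\<^sup>2 * u k \<le> (\<Sum>k\<in>S. s\<^sup>2 * u k)"
      using S u0 by (intro member_le_sum) auto
    then show "s\<^sup>2 * u k \<in> {0..1}" using half u0 by simp
  qed
  with half have low: "1 / 2 \<le> \<bar>\<Prod>k\<in>S. 1 - s\<^sup>2 * u k\<bar>" by linarith
  have "real n * s\<^sup>2 / 2 \<le> 1 / 2"
  proof -
    have "real n * s\<^sup>2 \<le> real n * (1 / (36 * real n ^ 4))"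
      using s2 by (intro mult_left_mono) auto
    also have "\<dots> = 1 / (36 * real n ^ 3)" using n by (simp add: field_simps power_numeral_reduce)
    also have "\<dots> \<le> 1"
    proof -
      have "1 \<le> real n ^ 3" using n by (intro one_le_power) auto
      then have "1 \<le> 36 * real n ^ 3" by linarith
      then show ?thesis by (subst divide_le_eq_1_pos) linarith+
    qed
    finally show ?thesis by simp
  qed
  then have e: "1 / 2 \<le> exp (- (real n * s\<^sup>2 / 2))"
    using exp_ge_add_one_self[of "- (real n * s\<^sup>2 / 2)"] by linarith
  \<comment> \<open>One factor \<open>F\<close> is kept and the other bounded by M / 2; the product
    and the exponential each cost 1 / 2. The reflected value at t0 - s is at most \<open>M\<close>
    and cancels, leaving F / 8 \<ge> M / 16.\<close>
  have "F * (M / 2) * (1 / 2) * (1 / 2) \<le> F * F * \<bar>\<Prod>k\<in>S. 1 - s\<^sup>2 * u k\<bar> * exp (- (real n * s\<^sup>2 / 2))"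
    using F M low e by (intro mult_mono) auto
  also have "\<dots> = \<bar>f (t0 + s)\<bar> * \<bar>f (t0 - s)\<bar>"
    by (simp add: pm power2_eq_square)
  also have "\<dots> \<le> \<bar>f (t0 + s)\<bar> * M"
    using bd by (intro mult_left_mono) auto
  finally have "F * (1 / 8) * M \<le> \<bar>f (t0 + s)\<bar> * M" by simp
  then have "F * (1 / 8) \<le> \<bar>f (t0 + s)\<bar>" using M by (rule mult_right_le_imp_le)
  with F show ?thesis by simp
qed

text \<open>Each factor grows at most like exp(t^2 / 4), and the weight pays for \<open>n\<close>
  such factors. This makes the real-valued supremum of |f| meaningful.\<close>

lemma weighted_poly_bounded:
  fixes n :: nat and c :: real and S :: "'a set" and x :: "'a \<Rightarrow> real"
  assumes S: "finite S" "card S \<le> n"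
  shows "\<exists>B. \<forall>t. \<bar>weighted_poly n c S x t\<bar> \<le> B"
proof (intro exI allI)
  fix t :: real
  have "\<bar>t - x k\<bar> \<le> (1 + \<bar>x k\<bar>) * exp (t\<^sup>2 / 4)" for k
  proof -
    have "\<bar>t\<bar> \<le> 1 + t\<^sup>2 / 4"
      using zero_le_power2[of "\<bar>t\<bar> / 2 - 1"] by (simp add: power2_eq_square algebra_simps)
    then have "\<bar>t\<bar> \<le> exp (t\<^sup>2 / 4)" using exp_ge_add_one_self[of "t\<^sup>2 / 4"] by linarith
    moreover have "\<bar>x k\<bar> * 1 \<le> \<bar>x k\<bar> * exp (t\<^sup>2 / 4)" by (intro mult_left_mono) auto
    ultimately show ?thesis by (simp add: algebra_simps)
  qed
  then have "(\<Prod>k\<in>S. \<bar>t - x k\<bar>) \<le> (\<Prod>k\<in>S. (1 + \<bar>x k\<bar>) * exp (t\<^sup>2 / 4))"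
    by (intro prod_mono) auto
  also have "\<dots> = (\<Prod>k\<in>S. 1 + \<bar>x k\<bar>) * exp (real (card S) / 4 * t\<^sup>2)"
    by (simp add: prod.distrib flip: exp_of_nat_mult)
  also have "\<dots> \<le> (\<Prod>k\<in>S. 1 + \<bar>x k\<bar>) * exp (real n / 4 * t\<^sup>2)"
    using S by (intro mult_left_mono) (auto intro!: prod_nonneg mult_right_mono)
  finally have "(\<Prod>k\<in>S. \<bar>t - x k\<bar>) * exp (- (real n / 4) * t\<^sup>2) \<le> (\<Prod>k\<in>S. 1 + \<bar>x k\<bar>)"
    by (simp add: exp_minus field_simps)
  then have "\<bar>c\<bar> * ((\<Prod>k\<in>S. \<bar>t - x k\<bar>) * exp (- (real n / 4) * t\<^sup>2)) \<le> \<bar>c\<bar> * (\<Prod>k\<in>S. 1 + \<bar>x k\<bar>)"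
    by (intro mult_left_mono) auto
  then show "\<bar>weighted_poly n c S x t\<bar> \<le> \<bar>c\<bar> * (\<Prod>k\<in>S. 1 + \<bar>x k\<bar>)"
    by (simp add: weighted_poly_def abs_mult abs_prod mult.assoc)
qed

text \<open>A point with |f| \<ge> M / 2 exists by the definition of the supremum, so whether the
  supremum is attained need not be discussed; this is why flatness was proved around
  near-maximizers. The factor 3 n^2 is the inverse of the length 2 \<open>h\<close> of the flat
  interval.\<close>

lemma weighted_poly_sup_le_integral:
  fixes n :: nat and c :: real and S :: "'a set" and x :: "'a \<Rightarrow> real"
  defines "f \<equiv> weighted_poly n c S x"
  assumes S: "finite S" "card S \<le> n" and n: "n \<ge> 1" and \<beta>: "\<beta> > 0" and K: "K \<ge> 0"
    and int: "(\<integral>\<^sup>+t. ennreal (\<bar>f t\<bar> powr \<beta>) \<partial>lborel) \<le> ennreal K"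
  shows "\<bar>f t\<bar> \<le> 16 * (3 * real n ^ 2 * K) powr (1 / \<beta>)"
proof -
  define M where "M = (SUP t. \<bar>f t\<bar>)"
  have bdd: "bdd_above (range (\<lambda>t. \<bar>f t\<bar>))"
    using weighted_poly_bounded[OF S, where c = c and x = x] unfolding bdd_above_def f_def by blast
  have le: "\<bar>f t\<bar> \<le> M" for t
    unfolding M_def using bdd by (intro cSUP_upper) auto
  show ?thesis
  proof (cases "M > 0")
    \<comment> \<open>Here f vanishes identically, as happens for a Lagrange polynomial whose node
      coincides with another one.\<close>
    case False
    then have "\<bar>f t\<bar> \<le> 0" using le[of t] by linarith
    moreover have "0 \<le> 16 * (3 * real n ^ 2 * K) powr (1 / \<beta>)" by simp
    ultimately show ?thesis by linarith
  next
    case M: True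
    have "\<exists>t0. M / 2 < \<bar>f t0\<bar>"
      using less_cSUP_iff[OF _ bdd, of "M / 2"] M unfolding M_def by auto
    then obtain t0 where t0: "M / 2 \<le> \<bar>f t0\<bar>" using less_imp_le by blast
    define h where "h = 1 / (6 * real n ^ 2)"
    have h: "h > 0" using n by (simp add: h_def)
    have flat: "M / 16 \<le> \<bar>f r\<bar>" if "r \<in> {t0 - h..t0 + h}" for r
    proof -
      have "\<bar>r - t0\<bar> \<le> 1 / (6 * real n ^ 2)" using that unfolding h_def by auto
      then have "M / 16 \<le> \<bar>f (t0 + (r - t0))\<bar>"
        using weighted_poly_flat_near_max[OF S n M, where c = c and x = x and ?t0.0 = t0 and s = "r - t0"] le t0 unfolding f_def by blast
      then show ?thesis by simp
    qed
    have "ennreal ((M / 16) powr \<beta> * (2 * h)) = (\<integral>\<^sup>+r. ennreal ((M / 16) powr \<beta>) * indicator {t0 - h..t0 + h} r \<partial>lborel)"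
      using h by (simp add: nn_integral_cmult_indicator ennreal_mult)
    also have "\<dots> \<le> (\<integral>\<^sup>+r. ennreal (\<bar>f r\<bar> powr \<beta>) \<partial>lborel)"
      using flat M \<beta> by (intro nn_integral_mono) (auto simp: indicator_def intro!: ennreal_leI powr_mono2)
    also note int
    finally have "(M / 16) powr \<beta> * (2 * h) \<le> K" using K by simp
    then have "(M / 16) powr \<beta> \<le> 3 * real n ^ 2 * K"
      using n by (simp add: h_def field_simps)
    then have "((M / 16) powr \<beta>) powr (1 / \<beta>) \<le> (3 * real n ^ 2 * K) powr (1 / \<beta>)"
      using \<beta> by (intro powr_mono2) auto
    then have "M / 16 \<le> (3 * real n ^ 2 * K) powr (1 / \<beta>)"
      using \<beta> M by (simp add: powr_powr)
    with le[of t] show ?thesis by linarith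
  qed
qed

section \<open>Moving one point of the configuration\<close>

interpretation lborel_product: product_sigma_finite "\<lambda>_::nat. lborel :: real measure"
  by standard

lemma beta_weight_nonneg: "beta_weight \<beta> n x \<ge> 0"
  unfolding beta_weight_def by (intro mult_nonneg_nonneg prod_nonneg) auto

lemma component_measurable_lebesgue_Rn:
  "k \<in> {1..n} \<Longrightarrow> (\<lambda>x. x k) \<in> borel_measurable (lebesgue_Rn n)"
  using measurable_component_singleton[of k "{1..n}" "\<lambda>_. lborel :: real measure"] by simp

lemma beta_weight_measurable [measurable]:
  "beta_weight \<beta> n \<in> borel_measurable (lebesgue_Rn n)"
  unfolding beta_weight_def
  by (intro borel_measurable_times borel_measurable_prod powr_real_measurable borel_measurable_abs
      borel_measurable_diff borel_measurable_exp[THEN measurable_compose_rev] borel_measurable_sum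
      borel_measurable_power borel_measurable_const component_measurable_lebesgue_Rn) auto

lemma weighted_lagrange_measurable:
  assumes "j \<in> {1..n}"
  shows "(\<lambda>(x, t). weighted_lagrange n x j t) \<in> borel_measurable (lebesgue_Rn n \<Otimes>\<^sub>M lborel)"
proof -
  have [measurable]: "(\<lambda>z. fst z k) \<in> borel_measurable (lebesgue_Rn n \<Otimes>\<^sub>M lborel)" if "k \<in> {1..n}" for k
    using measurable_compose[OF measurable_fst component_measurable_lebesgue_Rn[OF that]] .
  have [measurable]: "snd \<in> borel_measurable (lebesgue_Rn n \<Otimes>\<^sub>M (lborel :: real measure))"
    using measurable_snd by simp
  show ?thesis
    unfolding weighted_lagrange_def case_prod_unfold using assms
    by (intro borel_measurable_times borel_measurable_prod) measurable
qed

text \<open>Index \<open>j\<close> occurs as the larger member of pairs with a < j and as the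
  smaller member of pairs with b > j. Symmetry of \<open>g\<close> merges the two families into one
  product over all other indices.\<close>

lemma pair_product_remove:
  fixes g :: "nat \<Rightarrow> nat \<Rightarrow> real"
  assumes j: "j \<in> {1..n}" and sym: "\<And>a b. g a b = g b a"
  shows "(\<Prod>b\<in>{1..n}. \<Prod>a\<in>{1..<b}. g a b)
    = (\<Prod>b\<in>{1..n} - {j}. \<Prod>a\<in>{1..<b} - {j}. g a b) * (\<Prod>a\<in>{1..n} - {j}. g a j)"
proof -
  have 1: "(\<Prod>a\<in>{1..<b}. g a b) = (\<Prod>a\<in>{1..<b} - {j}. g a b) * (if j < b then g b j else 1)"
    if "b \<in> {1..n} - {j}" for b
    using j prod.remove[of "{1..<b}" j "\<lambda>a. g a b"] by (cases "j < b") (simp_all add: sym[of b j] mult.commute)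
  have "(\<Prod>b\<in>{1..n}. \<Prod>a\<in>{1..<b}. g a b)
     = (\<Prod>a\<in>{1..<j}. g a j) * (\<Prod>b\<in>{1..n} - {j}. \<Prod>a\<in>{1..<b}. g a b)"
    using j by (simp add: prod.remove)
  also have "(\<Prod>b\<in>{1..n} - {j}. \<Prod>a\<in>{1..<b}. g a b)
     = (\<Prod>b\<in>{1..n} - {j}. \<Prod>a\<in>{1..<b} - {j}. g a b) * (\<Prod>b\<in>{1..n} - {j}. if j < b then g b j else 1)"
    unfolding prod.distrib[symmetric] by (rule prod.cong[OF refl 1])
  also have "(\<Prod>b\<in>{1..n} - {j}. if j < b then g b j else 1) = (\<Prod>b\<in>{j<..n}. g b j)"
    using j by (intro prod.mono_neutral_cong_right) auto
  also have "(\<Prod>a\<in>{1..<j}. g a j) * ((\<Prod>b\<in>{1..n} - {j}. \<Prod>a\<in>{1..<b} - {j}. g a b) * (\<Prod>b\<in>{j<..n}. g b j))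
     = (\<Prod>b\<in>{1..n} - {j}. \<Prod>a\<in>{1..<b} - {j}. g a b) * ((\<Prod>a\<in>{1..<j}. g a j) * (\<Prod>b\<in>{j<..n}. g b j))"
    by (simp add: mult_ac)
  also have "(\<Prod>a\<in>{1..<j}. g a j) * (\<Prod>b\<in>{j<..n}. g b j) = (\<Prod>a\<in>{1..<j} \<union> {j<..n}. g a j)"
    by (rule prod.union_disjoint[symmetric]) auto
  also have "{1..<j} \<union> {j<..n} = {1..n} - {j}"
    using j by auto
  finally show ?thesis .
qed

text \<open>The first bracket does not involve \<open>x j\<close>, so it survives the replacement of
  \<open>x j\<close> by \<open>t\<close> unchanged.\<close>

lemma beta_weight_remove:
  assumes j: "j \<in> {1..n}"
  shows "beta_weight \<beta> n x =
     ((\<Prod>b\<in>{1..n} - {j}. \<Prod>a\<in>{1..<b} - {j}. \<bar>x a - x b\<bar> powr \<beta>)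
        * exp (- real n * (\<beta> / 4) * (\<Sum>k\<in>{1..n} - {j}. (x k)\<^sup>2)))
     * ((\<Prod>k\<in>{1..n} - {j}. \<bar>x k - x j\<bar> powr \<beta>) * exp (- real n * (\<beta> / 4) * (x j)\<^sup>2))"
proof -
  have "(\<Sum>k\<in>{1..n}. (1 / 2) * (x k)\<^sup>2) = (1 / 2) * ((\<Sum>k\<in>{1..n} - {j}. (x k)\<^sup>2) + (x j)\<^sup>2)"
    unfolding sum_distrib_left[symmetric] using j by (subst sum.remove[of _ j]) simp_all
  then have "exp (- real n * (\<beta> / 2) * (\<Sum>k\<in>{1..n}. (1 / 2) * (x k)\<^sup>2))
     = exp (- real n * (\<beta> / 4) * (\<Sum>k\<in>{1..n} - {j}. (x k)\<^sup>2)) * exp (- real n * (\<beta> / 4) * (x j)\<^sup>2)"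
    by (simp add: algebra_simps flip: exp_add)
  then show ?thesis
    unfolding beta_weight_def
    by (subst pair_product_remove[OF j, of "\<lambda>a b. \<bar>x a - x b\<bar> powr \<beta>"])
       (simp_all add: abs_minus_commute mult_ac)
qed

text \<open>
  Equality holds unless \<open>x j\<close> coincides with another point; then \<open>weighted_lagrange\<close> vanishes
  because of \<open>y / 0 = 0\<close>.
\<close>

lemma beta_weight_mult_lagrange_le:
  assumes j: "j \<in> {1..n}" and "\<beta> > 0"
  shows "beta_weight \<beta> n x * \<bar>weighted_lagrange n x j t\<bar> powr \<beta> \<le> beta_weight \<beta> n (x(j := t))"
proof -
  define A where "A = (\<Prod>b\<in>{1..n} - {j}. \<Prod>a\<in>{1..<b} - {j}. \<bar>x a - x b\<bar> powr \<beta>)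
        * exp (- real n * (\<beta> / 4) * (\<Sum>k\<in>{1..n} - {j}. (x k)\<^sup>2))"
  have A: "A \<ge> 0" unfolding A_def by (intro mult_nonneg_nonneg prod_nonneg) (auto intro: prod_nonneg)
  have "\<bar>weighted_lagrange n x j t\<bar> powr \<beta>
      = (\<Prod>k\<in>{1..n} - {j}. \<bar>t - x k\<bar> powr \<beta> / \<bar>x j - x k\<bar> powr \<beta>)
        * exp (- (1 / 4) * real n * (t\<^sup>2 - (x j)\<^sup>2)) powr \<beta>"
    unfolding weighted_lagrange_def
    by (simp add: abs_mult powr_mult abs_prod prod_powr_distrib powr_divide prod_nonneg)
  also have "exp (- (1 / 4) * real n * (t\<^sup>2 - (x j)\<^sup>2)) powr \<beta>
      = exp (- real n * (\<beta> / 4) * (t\<^sup>2 - (x j)\<^sup>2))"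
    by (simp add: powr_def)
  finally have "((\<Prod>k\<in>{1..n} - {j}. \<bar>x k - x j\<bar> powr \<beta>) * exp (- real n * (\<beta> / 4) * (x j)\<^sup>2))
        * \<bar>weighted_lagrange n x j t\<bar> powr \<beta>
      = (\<Prod>k\<in>{1..n} - {j}. \<bar>x k - x j\<bar> powr \<beta> * (\<bar>t - x k\<bar> powr \<beta> / \<bar>x j - x k\<bar> powr \<beta>))
        * (exp (- real n * (\<beta> / 4) * (x j)\<^sup>2) * exp (- real n * (\<beta> / 4) * (t\<^sup>2 - (x j)\<^sup>2)))"
    by (simp only: prod.distrib mult_ac)
  also have "exp (- real n * (\<beta> / 4) * (x j)\<^sup>2) * exp (- real n * (\<beta> / 4) * (t\<^sup>2 - (x j)\<^sup>2))
      = exp (- real n * (\<beta> / 4) * t\<^sup>2)"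
    by (simp add: algebra_simps flip: exp_add)
  also have "(\<Prod>k\<in>{1..n} - {j}. \<bar>x k - x j\<bar> powr \<beta> * (\<bar>t - x k\<bar> powr \<beta> / \<bar>x j - x k\<bar> powr \<beta>))
        * exp (- real n * (\<beta> / 4) * t\<^sup>2)
      \<le> (\<Prod>k\<in>{1..n} - {j}. \<bar>x k - t\<bar> powr \<beta>) * exp (- real n * (\<beta> / 4) * t\<^sup>2)"
    by (intro mult_right_mono prod_mono) (auto simp: abs_minus_commute)
  finally have "A * (((\<Prod>k\<in>{1..n} - {j}. \<bar>x k - x j\<bar> powr \<beta>) * exp (- real n * (\<beta> / 4) * (x j)\<^sup>2))
        * \<bar>weighted_lagrange n x j t\<bar> powr \<beta>)
      \<le> A * ((\<Prod>k\<in>{1..n} - {j}. \<bar>x k - t\<bar> powr \<beta>) * exp (- real n * (\<beta> / 4) * t\<^sup>2))"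
    using A by (intro mult_left_mono)
  also have "\<dots> = beta_weight \<beta> n (x(j := t))"
    unfolding A_def by (subst beta_weight_remove[OF j])
      (intro arg_cong2[where f = "(*)"] arg_cong[where f = exp] prod.cong sum.cong refl; auto)
  finally show ?thesis
    by (subst beta_weight_remove[OF j]) (simp add: A_def mult.assoc)
qed

text \<open>After the exchange the weight sees only the new position \<open>t\<close>, while
  \<open>f\<close> sees only the old position \<open>y\<close>. The integral over \<open>y\<close>
  thus splits off, and integrating \<open>t\<close> together with the other coordinates restores the
  total weight.\<close>

lemma nn_integral_beta_weight_lagrange_le:
  assumes j: "j \<in> {1..n}" and \<beta>: "\<beta> > 0" and [measurable]: "f \<in> borel_measurable lborel"
  shows "(\<integral>\<^sup>+x. ennreal (beta_weight \<beta> n x) * (f (x j) *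
            (\<integral>\<^sup>+t. ennreal (\<bar>weighted_lagrange n x j t\<bar> powr \<beta>) \<partial>lborel)) \<partial>lebesgue_Rn n)
     \<le> (\<integral>\<^sup>+y. f y \<partial>lborel) * (\<integral>\<^sup>+x. ennreal (beta_weight \<beta> n x) \<partial>lebesgue_Rn n)"
proof -
  define I where "I = {1..n} - {j}"
  have I: "finite I" "j \<notin> I" "{1..n} = insert j I" using j by (auto simp: I_def)
  note [measurable] = weighted_lagrange_measurable[OF j]
  have W: "(\<lambda>x. ennreal (beta_weight \<beta> n x)) \<in> borel_measurable (Pi\<^sub>M (insert j I) (\<lambda>_. lborel))"
    unfolding I(3)[symmetric] by measurable
  have F: "(\<lambda>x. ennreal (beta_weight \<beta> n x) * (f (x j) *
            (\<integral>\<^sup>+t. ennreal (\<bar>weighted_lagrange n x j t\<bar> powr \<beta>) \<partial>lborel)))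
      \<in> borel_measurable (Pi\<^sub>M (insert j I) (\<lambda>_. lborel))"
    unfolding I(3)[symmetric] using j by measurable
  have "ennreal (beta_weight \<beta> n (x(j := y))) * (f ((x(j := y)) j) *
            (\<integral>\<^sup>+t. ennreal (\<bar>weighted_lagrange n (x(j := y)) j t\<bar> powr \<beta>) \<partial>lborel))
        \<le> f y * (\<integral>\<^sup>+t. ennreal (beta_weight \<beta> n (x(j := t))) \<partial>lborel)"
     if x: "x \<in> space (Pi\<^sub>M I (\<lambda>_. lborel))" for x :: "nat \<Rightarrow> real" and y
  proof -
    have [measurable]: "(\<lambda>t. weighted_lagrange n (x(j := y)) j t) \<in> borel_measurable borel"
      unfolding weighted_lagrange_def by measurable
    have "ennreal (beta_weight \<beta> n (x(j := y))) * (\<integral>\<^sup>+t. ennreal (\<bar>weighted_lagrange n (x(j := y)) j t\<bar> powr \<beta>) \<partial>lborel)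
       = (\<integral>\<^sup>+t. ennreal (beta_weight \<beta> n (x(j := y)) * \<bar>weighted_lagrange n (x(j := y)) j t\<bar> powr \<beta>) \<partial>lborel)"
      by (subst nn_integral_cmult[symmetric]) (auto simp: ennreal_mult' beta_weight_nonneg)
    also have "\<dots> \<le> (\<integral>\<^sup>+t. ennreal (beta_weight \<beta> n (x(j := t))) \<partial>lborel)"
      using beta_weight_mult_lagrange_le[OF j \<beta>, of "x(j := y)"]
      by (intro nn_integral_mono ennreal_leI) simp
    finally show ?thesis
      by (simp add: mult.left_commute mult_left_mono)
  qed
  then have "(\<integral>\<^sup>+x. ennreal (beta_weight \<beta> n x) * (f (x j) *
            (\<integral>\<^sup>+t. ennreal (\<bar>weighted_lagrange n x j t\<bar> powr \<beta>) \<partial>lborel)) \<partial>lebesgue_Rn n)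
     \<le> (\<integral>\<^sup>+x. \<integral>\<^sup>+y. f y * (\<integral>\<^sup>+t. ennreal (beta_weight \<beta> n (x(j := t))) \<partial>lborel) \<partial>lborel \<partial>Pi\<^sub>M I (\<lambda>_. lborel))"
    unfolding I(3) lborel_product.product_nn_integral_insert[OF I(1,2) F]
    by (intro nn_integral_mono) auto
  also have "\<dots> = (\<integral>\<^sup>+x. (\<integral>\<^sup>+y. f y \<partial>lborel) * (\<integral>\<^sup>+t. ennreal (beta_weight \<beta> n (x(j := t))) \<partial>lborel) \<partial>Pi\<^sub>M I (\<lambda>_. lborel))"
    by (simp add: nn_integral_multc)
  also have "\<dots> = (\<integral>\<^sup>+y. f y \<partial>lborel) * (\<integral>\<^sup>+x. \<integral>\<^sup>+t. ennreal (beta_weight \<beta> n (x(j := t))) \<partial>lborel \<partial>Pi\<^sub>M I (\<lambda>_. lborel))"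
  proof (rule nn_integral_cmult)
    have "(\<lambda>(x, t). ennreal (beta_weight \<beta> n (x(j := t)))) \<in> borel_measurable (Pi\<^sub>M I (\<lambda>_. lborel) \<Otimes>\<^sub>M lborel)"
      using measurable_compose[OF measurable_add_dim W] by (simp add: case_prod_unfold)
    then show "(\<lambda>x. \<integral>\<^sup>+t. ennreal (beta_weight \<beta> n (x(j := t))) \<partial>lborel) \<in> borel_measurable (Pi\<^sub>M I (\<lambda>_. lborel))"
      by (rule lborel.borel_measurable_nn_integral)
  qed
  also have "(\<integral>\<^sup>+x. \<integral>\<^sup>+t. ennreal (beta_weight \<beta> n (x(j := t))) \<partial>lborel \<partial>Pi\<^sub>M I (\<lambda>_. lborel))
     = (\<integral>\<^sup>+x. ennreal (beta_weight \<beta> n x) \<partial>lebesgue_Rn n)"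
    unfolding I(3) lborel_product.product_nn_integral_insert[OF I(1,2) W] ..
  finally show ?thesis .
qed

section \<open>Normalization and tails of the ensemble\<close>

text \<open>Change of variables for a dilation, one coordinate at a time from the affine
  substitution on the line. The restriction \<lambda>i\<in>I keeps the image a point of the product
  space, whose elements are \<open>undefined\<close> off \<open>I\<close>.\<close>

lemma nn_integral_PiM_lborel_scale:
  fixes c :: real and f :: "(nat \<Rightarrow> real) \<Rightarrow> ennreal"
  assumes "finite I" and c: "c > 0" and "f \<in> borel_measurable (Pi\<^sub>M I (\<lambda>_. lborel))"
  shows "(\<integral>\<^sup>+x. f x \<partial>Pi\<^sub>M I (\<lambda>_. lborel))
       = ennreal c ^ card I * (\<integral>\<^sup>+x. f (\<lambda>i\<in>I. c * x i) \<partial>Pi\<^sub>M I (\<lambda>_. lborel))"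
  using assms(1,3)
proof (induction I arbitrary: f rule: finite_induct)
  case empty
  have "(\<lambda>i\<in>{}. c * x i) = x" if "x \<in> space (Pi\<^sub>M {} (\<lambda>_::nat. lborel :: real measure))" for x
    using that by (auto simp: space_PiM)
  then show ?case by (simp cong: nn_integral_cong)
next
  case (insert i I)
  let ?L = "\<lambda>_::nat. lborel :: real measure"
  note [measurable] = insert.prems
  define T where "T x = (\<lambda>k\<in>insert i I. c * x k)" for x :: "nat \<Rightarrow> real"
  have T: "T \<in> measurable (Pi\<^sub>M (insert i I) ?L) (Pi\<^sub>M (insert i I) ?L)"
    unfolding T_def by (rule measurable_restrict) measurable
  have add: "(\<lambda>z. (fst z)(i := snd z)) \<in> measurable (Pi\<^sub>M I ?L \<Otimes>\<^sub>M lborel) (Pi\<^sub>M (insert i I) ?L)"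
    using measurable_add_dim[of i I ?L] by (simp add: case_prod_unfold)
  have "(\<lambda>z. f ((fst z)(i := c * snd z))) \<in> borel_measurable (Pi\<^sub>M I ?L \<Otimes>\<^sub>M lborel)"
  proof -
    have "(\<lambda>z. (fst z, c * snd z)) \<in> measurable (Pi\<^sub>M I ?L \<Otimes>\<^sub>M lborel) (Pi\<^sub>M I ?L \<Otimes>\<^sub>M (lborel :: real measure))"
      by measurable
    from measurable_compose[OF measurable_compose[OF this add] insert.prems] show ?thesis by simp
  qed
  then have g: "(\<lambda>x. \<integral>\<^sup>+y. f (x(i := c * y)) \<partial>lborel) \<in> borel_measurable (Pi\<^sub>M I ?L)"
    by (intro lborel.borel_measurable_nn_integral) (simp add: case_prod_unfold)
  have "(\<integral>\<^sup>+x. f x \<partial>Pi\<^sub>M (insert i I) ?L) = (\<integral>\<^sup>+x. \<integral>\<^sup>+y. f (x(i := y)) \<partial>lborel \<partial>Pi\<^sub>M I ?L)"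
    using insert by (intro lborel_product.product_nn_integral_insert) auto
  also have "\<dots> = (\<integral>\<^sup>+x. ennreal c * (\<integral>\<^sup>+y. f (x(i := c * y)) \<partial>lborel) \<partial>Pi\<^sub>M I ?L)"
  proof (rule nn_integral_cong)
    fix x assume "x \<in> space (Pi\<^sub>M I ?L)"
    then have "(\<lambda>y. (x, y)) \<in> measurable (lborel :: real measure) (Pi\<^sub>M I ?L \<Otimes>\<^sub>M lborel)"
      by (rule measurable_Pair1')
    from measurable_compose[OF measurable_compose[OF this add] insert.prems]
    have "(\<lambda>y. f (x(i := y))) \<in> borel_measurable borel" by (simp add: fun_upd_def)
    from nn_integral_real_affine[OF this, of c 0] c
    show "(\<integral>\<^sup>+y. f (x(i := y)) \<partial>lborel) = ennreal c * (\<integral>\<^sup>+y. f (x(i := c * y)) \<partial>lborel)" by simp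
  qed
  also have "\<dots> = ennreal c * (\<integral>\<^sup>+x. \<integral>\<^sup>+y. f (x(i := c * y)) \<partial>lborel \<partial>Pi\<^sub>M I ?L)"
    by (rule nn_integral_cmult[OF g])
  also have "(\<integral>\<^sup>+x. \<integral>\<^sup>+y. f (x(i := c * y)) \<partial>lborel \<partial>Pi\<^sub>M I ?L)
     = ennreal c ^ card I * (\<integral>\<^sup>+x. \<integral>\<^sup>+y. f ((\<lambda>k\<in>I. c * x k)(i := c * y)) \<partial>lborel \<partial>Pi\<^sub>M I ?L)"
    by (rule insert.IH[OF g])
  also have "(\<integral>\<^sup>+x. \<integral>\<^sup>+y. f ((\<lambda>k\<in>I. c * x k)(i := c * y)) \<partial>lborel \<partial>Pi\<^sub>M I ?L)
     = (\<integral>\<^sup>+x. \<integral>\<^sup>+y. f (T (x(i := y))) \<partial>lborel \<partial>Pi\<^sub>M I ?L)"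
  proof -
    have "(\<lambda>k\<in>I. c * x k)(i := c * y) = T (x(i := y))" for x y
      using insert by (auto simp: T_def fun_eq_iff)
    then show ?thesis by simp
  qed
  also have "\<dots> = (\<integral>\<^sup>+x. f (T x) \<partial>Pi\<^sub>M (insert i I) ?L)"
    using insert measurable_compose[OF T insert.prems]
    by (intro lborel_product.product_nn_integral_insert[symmetric]) auto
  finally show ?case
    by (simp only: T_def card_insert_disjoint[OF insert(1,2)] power_Suc mult.assoc)
qed

text \<open>Each |a - b| is at most exp(|a| + |b|), so all interactions together cost 2 n \<beta>
  |x_k| per point. Half of the quadratic confinement absorbs this linear term, by (|y| - 8)^2 \<ge>
  0.\<close>

lemma beta_weight_le_gaussian:
  assumes "\<beta> > 0"
  shows "beta_weight \<beta> n x \<le> (\<Prod>k\<in>{1..n}. exp (real n * \<beta> * (8 - (x k)\<^sup>2 / 8)))"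
proof -
  have "\<bar>a - b\<bar> powr \<beta> \<le> exp (\<beta> * (\<bar>a\<bar> + \<bar>b\<bar>))" for a b :: real
  proof -
    have "\<bar>a - b\<bar> \<le> exp (\<bar>a\<bar> + \<bar>b\<bar>)"
      using exp_ge_add_one_self[of "\<bar>a\<bar> + \<bar>b\<bar>"] by linarith
    then have "\<bar>a - b\<bar> powr \<beta> \<le> exp (\<bar>a\<bar> + \<bar>b\<bar>) powr \<beta>"
      using assms by (intro powr_mono2) auto
    then show ?thesis by (simp add: powr_def)
  qed
  then have "(\<Prod>b\<in>{1..n}. \<Prod>a\<in>{1..<b}. \<bar>x a - x b\<bar> powr \<beta>)
      \<le> (\<Prod>b\<in>{1..n}. \<Prod>a\<in>{1..<b}. exp (\<beta> * (\<bar>x a\<bar> + \<bar>x b\<bar>)))"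
    by (intro prod_mono conjI prod_nonneg) auto
  also have "\<dots> \<le> (\<Prod>b\<in>{1..n}. \<Prod>a\<in>{1..n}. exp (\<beta> * (\<bar>x a\<bar> + \<bar>x b\<bar>)))"
    using assms by (intro prod_mono conjI prod_nonneg prod_mono2) auto
  also have "\<dots> = exp (\<Sum>k\<in>{1..n}. 2 * real n * \<beta> * \<bar>x k\<bar>)"
    by (simp add: exp_sum[symmetric] distrib_left sum.distrib sum_distrib_left mult_ac)
  finally have "beta_weight \<beta> n x \<le> exp (\<Sum>k\<in>{1..n}. 2 * real n * \<beta> * \<bar>x k\<bar>)
      * exp (- real n * (\<beta> / 2) * (\<Sum>j\<in>{1..n}. (1 / 2) * (x j)\<^sup>2))"
    unfolding beta_weight_def by (intro mult_right_mono) auto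
  also have "\<dots> = exp (\<Sum>k\<in>{1..n}. real n * \<beta> * (2 * \<bar>x k\<bar> - (x k)\<^sup>2 / 4))"
    by (simp add: sum_distrib_left sum_negf[symmetric] sum.distrib[symmetric] algebra_simps flip: exp_add)
  also have "\<dots> \<le> exp (\<Sum>k\<in>{1..n}. real n * \<beta> * (8 - (x k)\<^sup>2 / 8))"
  proof -
    have "2 * \<bar>y\<bar> - y\<^sup>2 / 4 \<le> 8 - y\<^sup>2 / 8" for y :: real
      using zero_le_power2[of "\<bar>y\<bar> - 8"] by (simp add: power2_eq_square algebra_simps)
    then show ?thesis using assms by (intro exp_le_cancel_iff[THEN iffD2] sum_mono mult_left_mono) auto
  qed
  finally show ?thesis by (simp add: exp_sum)
qed

lemma nn_integral_beta_weight_finite: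
  assumes \<beta>: "\<beta> > 0"
  shows "(\<integral>\<^sup>+x. ennreal (beta_weight \<beta> n x) \<partial>lebesgue_Rn n) < \<infinity>"
proof -
  define g where "g y = exp (real n * \<beta> * (8 - y\<^sup>2 / 8))" for y :: real
  have g: "(\<integral>\<^sup>+y. ennreal (g y) \<partial>lborel) < \<infinity>" if "n \<ge> 1"
  proof -
    \<comment> \<open>Chosen so that 1 / (2 \<sigma>^2) = n \<beta> / 8, which makes
      \<open>g\<close> a multiple of a normal density.\<close>
    define \<sigma> where "\<sigma> = 2 / sqrt (real n * \<beta>)"
    have \<sigma>: "\<sigma> > 0" "\<sigma>\<^sup>2 = 4 / (real n * \<beta>)"
      using that \<beta> by (auto simp: \<sigma>_def power_divide)
    have "integrable lborel (\<lambda>y. sqrt (2 * pi * \<sigma>\<^sup>2) * exp (8 * real n * \<beta>) * normal_density 0 \<sigma> y)"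
      using \<sigma> by (intro integrable_mult_right integrable_normal_density) auto
    also have "(\<lambda>y. sqrt (2 * pi * \<sigma>\<^sup>2) * exp (8 * real n * \<beta>) * normal_density 0 \<sigma> y) = g"
      using \<sigma> \<beta> that by (auto simp: fun_eq_iff g_def normal_density_def algebra_simps simp flip: exp_add)
    finally show ?thesis
      unfolding integrable_iff_bounded by (simp add: g_def)
  qed
  have "(\<integral>\<^sup>+x. ennreal (beta_weight \<beta> n x) \<partial>lebesgue_Rn n)
      \<le> (\<integral>\<^sup>+x. (\<Prod>k\<in>{1..n}. ennreal (g (x k))) \<partial>lebesgue_Rn n)"
    using beta_weight_le_gaussian[OF \<beta>, of n]
    by (intro nn_integral_mono) (auto simp: g_def prod_ennreal intro!: ennreal_leI)
  also have "\<dots> = (\<Prod>k\<in>{1..n}. \<integral>\<^sup>+y. ennreal (g y) \<partial>lborel)"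
    by (intro lborel_product.product_nn_integral_prod) (auto simp: g_def)
  also have "\<dots> < \<infinity>"
    using g by (cases "n \<ge> 1") (auto simp: power_less_top_ennreal)
  finally show ?thesis .
qed

text \<open>On the box of disjoint intervals [k, k + 1/2] the points are distinct and the weight is
  positive, and the box has measure 2^(-n).\<close>

lemma nn_integral_beta_weight_pos:
  "(\<integral>\<^sup>+x. ennreal (beta_weight \<beta> n x) \<partial>lebesgue_Rn n) > 0"
proof (rule ccontr)
  assume "\<not> ?thesis"
  moreover have "(\<lambda>x. ennreal (beta_weight \<beta> n x)) \<in> borel_measurable (lebesgue_Rn n)"
    by measurable
  ultimately have "AE x in lebesgue_Rn n. ennreal (beta_weight \<beta> n x) = 0"
    by (simp only: nn_integral_0_iff_AE not_gr_zero)
  then have AE: "AE x in lebesgue_Rn n. \<not> 0 < beta_weight \<beta> n x"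
    by eventually_elim (simp add: ennreal_eq_0_iff)
  define Q where "Q = (\<Pi>\<^sub>E k\<in>{1..n}. {real k .. real k + 1 / 2})"
  have Q: "Q \<in> sets (lebesgue_Rn n)"
    unfolding Q_def by (intro sets_PiM_I_finite) auto
  have pos: "0 < beta_weight \<beta> n x" if "x \<in> Q" for x
  proof -
    have "x a \<noteq> x b" if "b \<in> {1..n}" "a \<in> {1..<b}" for a b
    proof -
      have "x a \<le> real a + 1 / 2" "real b \<le> x b" "real a + 1 \<le> real b"
        using \<open>x \<in> Q\<close> that by (auto simp: Q_def PiE_iff)
      then show ?thesis by linarith
    qed
    then show ?thesis
      unfolding beta_weight_def by (intro mult_pos_pos prod_pos) auto
  qed
  have "AE x in lebesgue_Rn n. x \<notin> Q"
    using AE by eventually_elim (use pos in auto)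
  then have "emeasure (lebesgue_Rn n) Q = 0"
    using AE_iff_null_sets[OF Q] null_setsD1 by blast
  moreover have "emeasure (lebesgue_Rn n) Q = (\<Prod>k\<in>{1..n}. ennreal (1 / 2))"
    unfolding Q_def by (subst lborel_product.emeasure_PiM) auto
  ultimately show False by simp
qed

text \<open>\<open>beta_Z\<close> is a Bochner integral, which would default to 0 without
  integrability; the Gaussian domination excludes this.\<close>

lemma ennreal_beta_Z:
  assumes "\<beta> > 0"
  shows "ennreal (beta_Z \<beta> n) = (\<integral>\<^sup>+x. ennreal (beta_weight \<beta> n x) \<partial>lebesgue_Rn n)"
  unfolding beta_Z_def using nn_integral_beta_weight_finite[OF assms, of n]
  by (intro nn_integral_eq_integral[symmetric] integrableI_nonneg beta_weight_measurable)
     (auto simp: beta_weight_nonneg)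

lemma beta_Z_pos:
  assumes "\<beta> > 0"
  shows "beta_Z \<beta> n > 0"
  using nn_integral_beta_weight_pos[where \<beta> = \<beta> and n = n] ennreal_beta_Z[OF assms, of n] by (metis ennreal_less_zero_iff)

lemma nn_integral_beta_ensemble:
  assumes \<beta>: "\<beta> > 0" and [measurable]: "g \<in> borel_measurable (lebesgue_Rn n)"
  shows "(\<integral>\<^sup>+x. g x \<partial>beta_ensemble \<beta> n)
       = (\<integral>\<^sup>+x. ennreal (beta_weight \<beta> n x) * g x \<partial>lebesgue_Rn n) / ennreal (beta_Z \<beta> n)"
proof -
  have "(\<integral>\<^sup>+x. g x \<partial>beta_ensemble \<beta> n)
     = (\<integral>\<^sup>+x. ennreal (beta_weight \<beta> n x / beta_Z \<beta> n) * g x \<partial>lebesgue_Rn n)"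
    unfolding beta_ensemble_def by (rule nn_integral_density) measurable
  also have "\<dots> = (\<integral>\<^sup>+x. (ennreal (beta_weight \<beta> n x) * g x) / ennreal (beta_Z \<beta> n) \<partial>lebesgue_Rn n)"
    using beta_Z_pos[OF \<beta>, of n]
    by (intro nn_integral_cong)
       (simp add: divide_ennreal[symmetric] beta_weight_nonneg divide_ennreal_def mult_ac)
  also have "\<dots> = (\<integral>\<^sup>+x. ennreal (beta_weight \<beta> n x) * g x \<partial>lebesgue_Rn n) / ennreal (beta_Z \<beta> n)"
    by (rule nn_integral_divide) measurable
  finally show ?thesis .
qed

lemma prob_space_beta_ensemble:
  assumes "\<beta> > 0"
  shows "prob_space (beta_ensemble \<beta> n)"
proof
  have "emeasure (beta_ensemble \<beta> n) (space (beta_ensemble \<beta> n)) = (\<integral>\<^sup>+x. 1 \<partial>beta_ensemble \<beta> n)"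
    by simp
  also have "\<dots> = ennreal (beta_Z \<beta> n) / ennreal (beta_Z \<beta> n)"
    using assms by (subst nn_integral_beta_ensemble) (auto simp: ennreal_beta_Z)
  also have "\<dots> = 1"
    using beta_Z_pos[OF assms, of n] by (simp add: divide_ennreal)
  finally show "emeasure (beta_ensemble \<beta> n) (space (beta_ensemble \<beta> n)) = 1" .
qed

lemma sets_beta_ensemble [simp, measurable_cong]:
  "sets (beta_ensemble \<beta> n) = sets (lebesgue_Rn n)"
  by (simp add: beta_ensemble_def)

lemma space_beta_ensemble [simp]: "space (beta_ensemble \<beta> n) = space (lebesgue_Rn n)"
  by (simp add: beta_ensemble_def)

section \<open>Probabilities of the exceptional events\<close>

lemma sum_squares_measurable [measurable]:
  "(\<lambda>x. \<Sum>k\<in>{1..n}. (x k)\<^sup>2 :: real) \<in> borel_measurable (lebesgue_Rn n)"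
  by (intro borel_measurable_sum borel_measurable_power component_measurable_lebesgue_Rn)

lemma lagrange_integral_measurable:
  assumes "j \<in> {1..n}"
  shows "(\<lambda>x. \<integral>\<^sup>+t. ennreal (\<bar>weighted_lagrange n x j t\<bar> powr \<beta>) \<partial>lborel)
    \<in> borel_measurable (lebesgue_Rn n)"
proof -
  note [measurable] = weighted_lagrange_measurable[OF assms]
  show ?thesis by measurable
qed

text \<open>Markov's inequality for the Lagrange integral cut off to \<open>x j\<close> in [-R, R].
  The numerator 2 R is the length of that interval, the normalizing constant having
  cancelled.\<close>

lemma emeasure_beta_ensemble_lagrange_integral_le:
  assumes j: "j \<in> {1..n}" and \<beta>: "\<beta> > 0" and R: "R \<ge> 0" and K: "K > 0"
  shows "emeasure (beta_ensemble \<beta> n) {x \<in> space (lebesgue_Rn n). x j \<in> {-R..R} \<and>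
      ennreal K \<le> (\<integral>\<^sup>+t. ennreal (\<bar>weighted_lagrange n x j t\<bar> powr \<beta>) \<partial>lborel)} \<le> ennreal (2 * R / K)"
    (is "emeasure ?P ?E \<le> _")
proof -
  define J where "J x = (\<integral>\<^sup>+t. ennreal (\<bar>weighted_lagrange n x j t\<bar> powr \<beta>) \<partial>lborel)" for x
  have J[measurable]: "J \<in> borel_measurable (lebesgue_Rn n)"
    using lagrange_integral_measurable[OF j, of \<beta>] unfolding J_def .
  have comp[measurable]: "(\<lambda>x. x j) \<in> borel_measurable (lebesgue_Rn n)"
    by (rule component_measurable_lebesgue_Rn[OF j])
  have "(\<lambda>x. indicator {-R..R} (x j) * J x :: ennreal) \<in> borel_measurable (lebesgue_Rn n)"
    by measurable
  note F = this
  have E: "?E \<in> sets (lebesgue_Rn n)"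
    unfolding J_def[symmetric] by measurable
  have "ennreal K * emeasure ?P ?E = (\<integral>\<^sup>+x. ennreal K * indicator ?E x \<partial>?P)"
    using E by (simp add: nn_integral_cmult_indicator)
  also have "\<dots> \<le> (\<integral>\<^sup>+x. indicator {-R..R} (x j) * J x \<partial>?P)"
    by (intro nn_integral_mono) (auto simp: indicator_def J_def)
  also have "\<dots> = (\<integral>\<^sup>+x. ennreal (beta_weight \<beta> n x) * (indicator {-R..R} (x j) * J x) \<partial>lebesgue_Rn n)
      / ennreal (beta_Z \<beta> n)"
    by (rule nn_integral_beta_ensemble[OF \<beta> F])
  also have "\<dots> \<le> ((\<integral>\<^sup>+y. indicator {-R..R} y \<partial>lborel) * ennreal (beta_Z \<beta> n)) / ennreal (beta_Z \<beta> n)"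
    using nn_integral_beta_weight_lagrange_le[OF j \<beta>, of "indicator {-R..R}"]
    unfolding J_def ennreal_beta_Z[OF \<beta>] by (intro divide_right_mono_ennreal) simp
  also have "\<dots> = ennreal (2 * R)"
    using R beta_Z_pos[OF \<beta>, of n] by (simp add: ennreal_mult''[symmetric] divide_ennreal)
  finally have le: "ennreal K * emeasure ?P ?E \<le> ennreal (2 * R)" .
  have "emeasure ?P ?E = ennreal (1 / K) * (ennreal K * emeasure ?P ?E)"
    using K by (simp add: mult.assoc[symmetric] ennreal_mult[symmetric])
  also have "\<dots> \<le> ennreal (1 / K) * ennreal (2 * R)"
    by (intro mult_left_mono le) simp
  also have "\<dots> = ennreal (2 * R / K)"
    using K R by (simp add: ennreal_mult[symmetric])
  finally show ?thesis .
qed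

text \<open>The dilation turns the Gaussian exponent -n \<beta> / 4 into -n \<beta> / 2 times the
  sum of squares, and the exponential in front adds n \<beta> / 4 back. What remains is a factor
  (sqrt 2)^\<beta> for each pair.\<close>

lemma beta_weight_scale_le:
  assumes \<beta>: "\<beta> > 0"
  shows "exp (real n * \<beta> / 8 * (\<Sum>k\<in>{1..n}. (sqrt 2 * x k)\<^sup>2)) * beta_weight \<beta> n (\<lambda>k\<in>{1..n}. sqrt 2 * x k)
    \<le> exp (\<beta> * real n ^ 2) * beta_weight \<beta> n x"
proof -
  have s: "1 \<le> sqrt 2 powr \<beta>" "sqrt 2 powr \<beta> \<le> exp \<beta>"
  proof -
    show "1 \<le> sqrt 2 powr \<beta>" using \<beta> by (intro ge_one_powr_ge_zero) auto
    have "sqrt 2 \<le> 2" by (rule real_le_lsqrt) auto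
    also have "\<dots> \<le> exp 1" using exp_ge_add_one_self[of 1] by simp
    finally have "sqrt 2 powr \<beta> \<le> exp 1 powr \<beta>" using \<beta> by (intro powr_mono2) auto
    then show "sqrt 2 powr \<beta> \<le> exp \<beta>" by (simp add: powr_def)
  qed
  define D where "D = (\<Prod>b\<in>{1..n}. \<Prod>a\<in>{1..<b}. \<bar>x a - x b\<bar> powr \<beta>)"
  have D: "D \<ge> 0" unfolding D_def by (intro prod_nonneg) (auto intro: prod_nonneg)
  have "(\<Prod>b\<in>{1..n}. \<Prod>a\<in>{1..<b}. \<bar>(\<lambda>k\<in>{1..n}. sqrt 2 * x k) a - (\<lambda>k\<in>{1..n}. sqrt 2 * x k) b\<bar> powr \<beta>)
      = (\<Prod>b\<in>{1..n}. \<Prod>a\<in>{1..<b}. sqrt 2 powr \<beta> * \<bar>x a - x b\<bar> powr \<beta>)"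
  proof (intro prod.cong refl)
    fix a b assume "b \<in> {1..n}" "a \<in> {1..<b}"
    then have "(\<lambda>k\<in>{1..n}. sqrt 2 * x k) a - (\<lambda>k\<in>{1..n}. sqrt 2 * x k) b = sqrt 2 * (x a - x b)"
      by (auto simp: algebra_simps)
    then show "\<bar>(\<lambda>k\<in>{1..n}. sqrt 2 * x k) a - (\<lambda>k\<in>{1..n}. sqrt 2 * x k) b\<bar> powr \<beta>
        = sqrt 2 powr \<beta> * \<bar>x a - x b\<bar> powr \<beta>"
      by (simp only: abs_mult powr_mult) simp
  qed
  also have "\<dots> = (\<Prod>b\<in>{1..n}. (sqrt 2 powr \<beta>) ^ (b - 1)) * D"
    by (simp add: prod.distrib D_def)
  \<comment> \<open>A generous bound, since b - 1 \<le> n and sqrt 2 \<le> e; the resulting exponent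
    \<beta> n^2 is later dominated by a cubic one.\<close>
  also have "(\<Prod>b\<in>{1..n}. (sqrt 2 powr \<beta>) ^ (b - 1)) \<le> (\<Prod>b\<in>{1..n}. (exp \<beta>) ^ n)"
  proof (intro prod_mono conjI)
    fix b assume "b \<in> {1..n}"
    then have "(sqrt 2 powr \<beta>) ^ (b - 1) \<le> (sqrt 2 powr \<beta>) ^ n"
      using s by (intro power_increasing) auto
    also have "\<dots> \<le> exp \<beta> ^ n" using s by (intro power_mono) auto
    finally show "(sqrt 2 powr \<beta>) ^ (b - 1) \<le> exp \<beta> ^ n" .
  qed simp
  also have "(\<Prod>b\<in>{1..n}. (exp \<beta>) ^ n) = exp (\<beta> * real n ^ 2)"
    by (simp add: power2_eq_square mult_ac flip: exp_of_nat_mult)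
  finally have P: "(\<Prod>b\<in>{1..n}. \<Prod>a\<in>{1..<b}. \<bar>(\<lambda>k\<in>{1..n}. sqrt 2 * x k) a - (\<lambda>k\<in>{1..n}. sqrt 2 * x k) b\<bar> powr \<beta>)
      \<le> exp (\<beta> * real n ^ 2) * D" using D by (simp add: mult_right_mono)
  have E: "exp (real n * \<beta> / 8 * (\<Sum>k\<in>{1..n}. (sqrt 2 * x k)\<^sup>2))
      * exp (- real n * (\<beta> / 2) * (\<Sum>k\<in>{1..n}. (1 / 2) * ((\<lambda>k\<in>{1..n}. sqrt 2 * x k) k)\<^sup>2))
    = exp (- real n * (\<beta> / 2) * (\<Sum>k\<in>{1..n}. (1 / 2) * (x k)\<^sup>2))"
  proof -
    have "(\<Sum>k\<in>{1..n}. (sqrt 2 * x k)\<^sup>2) = 2 * (\<Sum>k\<in>{1..n}. (x k)\<^sup>2)"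
      by (simp add: power_mult_distrib sum_distrib_left)
    moreover have "(\<Sum>k\<in>{1..n}. (1 / 2) * ((\<lambda>k\<in>{1..n}. sqrt 2 * x k) k)\<^sup>2) = (\<Sum>k\<in>{1..n}. (x k)\<^sup>2)"
      by (intro sum.cong) (auto simp: power_mult_distrib)
    moreover have "(\<Sum>k\<in>{1..n}. (1 / 2) * (x k)\<^sup>2) = (1 / 2) * (\<Sum>k\<in>{1..n}. (x k)\<^sup>2)"
      by (simp only: sum_distrib_left)
    ultimately show ?thesis
      unfolding mult_exp_exp by (intro arg_cong[of _ _ exp]) (simp only:, simp add: algebra_simps)
  qed
  have "exp (real n * \<beta> / 8 * (\<Sum>k\<in>{1..n}. (sqrt 2 * x k)\<^sup>2)) * beta_weight \<beta> n (\<lambda>k\<in>{1..n}. sqrt 2 * x k)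
    = (\<Prod>b\<in>{1..n}. \<Prod>a\<in>{1..<b}. \<bar>(\<lambda>k\<in>{1..n}. sqrt 2 * x k) a - (\<lambda>k\<in>{1..n}. sqrt 2 * x k) b\<bar> powr \<beta>)
      * exp (- real n * (\<beta> / 2) * (\<Sum>k\<in>{1..n}. (1 / 2) * (x k)\<^sup>2))"
    unfolding beta_weight_def E[symmetric] by (simp only: mult_ac)
  also have "\<dots> \<le> (exp (\<beta> * real n ^ 2) * D) * exp (- real n * (\<beta> / 2) * (\<Sum>k\<in>{1..n}. (1 / 2) * (x k)\<^sup>2))"
    using P by (rule mult_right_mono) simp
  also have "\<dots> = exp (\<beta> * real n ^ 2) * beta_weight \<beta> n x"
    unfolding beta_weight_def D_def by (simp only: mult.assoc)
  finally show ?thesis .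
qed

text \<open>The dilation gives the exponential moment at most exp(n + \<beta> n^2), where exp(n)
  bounds the Jacobian. On the event the integrand is at least exp(4 \<beta> n^3), which wins for n
  \<ge> 1; \<beta> \<ge> 1 serves to compare n with \<beta> n^3.\<close>

lemma emeasure_beta_ensemble_tail_le:
  assumes \<beta>: "\<beta> \<ge> 1" and n: "n \<ge> 1"
  shows "emeasure (beta_ensemble \<beta> n)
      {x \<in> space (lebesgue_Rn n). 32 * real n ^ 2 \<le> (\<Sum>k\<in>{1..n}. (x k)\<^sup>2)} \<le> ennreal (exp (- real n))"
    (is "emeasure ?P ?E \<le> _")
proof -
  have \<beta>0: "\<beta> > 0" using \<beta> by simp
  define S where "S x = (\<Sum>k\<in>{1..n}. (x k)\<^sup>2)" for x :: "nat \<Rightarrow> real"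
  have S[measurable]: "S \<in> borel_measurable (lebesgue_Rn n)"
    unfolding S_def by measurable
  have E: "?E \<in> sets (lebesgue_Rn n)"
    unfolding S_def[symmetric] by measurable
  have F: "(\<lambda>x. ennreal (exp (real n * \<beta> / 8 * S x))) \<in> borel_measurable (lebesgue_Rn n)"
    by measurable
  have G: "(\<lambda>x. ennreal (beta_weight \<beta> n x) * ennreal (exp (real n * \<beta> / 8 * S x)))
      \<in> borel_measurable (lebesgue_Rn n)"
    by measurable
  have W: "(\<lambda>x. ennreal (beta_weight \<beta> n x)) \<in> borel_measurable (lebesgue_Rn n)"
    by measurable
  have "(\<integral>\<^sup>+x. ennreal (beta_weight \<beta> n x) * ennreal (exp (real n * \<beta> / 8 * S x)) \<partial>lebesgue_Rn n)
     = ennreal (sqrt 2) ^ n * (\<integral>\<^sup>+x. ennreal (beta_weight \<beta> n (\<lambda>k\<in>{1..n}. sqrt 2 * x k))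
         * ennreal (exp (real n * \<beta> / 8 * S (\<lambda>k\<in>{1..n}. sqrt 2 * x k))) \<partial>lebesgue_Rn n)"
    using nn_integral_PiM_lborel_scale[OF _ _ G, of "sqrt 2"] by simp
  also have "\<dots> \<le> ennreal (exp 1) ^ n * (\<integral>\<^sup>+x. ennreal (exp (\<beta> * real n ^ 2)) * ennreal (beta_weight \<beta> n x) \<partial>lebesgue_Rn n)"
  proof (rule mult_mono)
    have "sqrt 2 \<le> 2" by (rule real_le_lsqrt) auto
    also have "\<dots> \<le> exp 1" using exp_ge_add_one_self[of 1] by simp
    finally show "ennreal (sqrt 2) ^ n \<le> ennreal (exp 1) ^ n"
      by (intro power_mono ennreal_leI) auto
    have "S (\<lambda>k\<in>{1..n}. sqrt 2 * x k) = (\<Sum>k\<in>{1..n}. (sqrt 2 * x k)\<^sup>2)" for x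
      unfolding S_def by (intro sum.cong) auto
    then have "ennreal (beta_weight \<beta> n (\<lambda>k\<in>{1..n}. sqrt 2 * x k))
         * ennreal (exp (real n * \<beta> / 8 * S (\<lambda>k\<in>{1..n}. sqrt 2 * x k)))
        \<le> ennreal (exp (\<beta> * real n ^ 2)) * ennreal (beta_weight \<beta> n x)" for x
      using beta_weight_scale_le[OF \<beta>0, of n x]
      by (subst (1 2) ennreal_mult[symmetric]) (auto simp: beta_weight_nonneg mult.commute intro!: ennreal_leI)
    then show "(\<integral>\<^sup>+x. ennreal (beta_weight \<beta> n (\<lambda>k\<in>{1..n}. sqrt 2 * x k))
         * ennreal (exp (real n * \<beta> / 8 * S (\<lambda>k\<in>{1..n}. sqrt 2 * x k))) \<partial>lebesgue_Rn n)
       \<le> (\<integral>\<^sup>+x. ennreal (exp (\<beta> * real n ^ 2)) * ennreal (beta_weight \<beta> n x) \<partial>lebesgue_Rn n)"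
      by (intro nn_integral_mono)
  qed auto
  also have "\<dots> = ennreal (exp (real n + \<beta> * real n ^ 2)) * ennreal (beta_Z \<beta> n)"
    unfolding nn_integral_cmult[OF W] ennreal_beta_Z[OF \<beta>0, symmetric]
    by (simp add: ennreal_power exp_add ennreal_mult mult.assoc exp_of_nat_mult[of _ 1, simplified])
  finally have "(\<integral>\<^sup>+x. ennreal (exp (real n * \<beta> / 8 * S x)) \<partial>?P)
      \<le> ennreal (exp (real n + \<beta> * real n ^ 2)) * ennreal (beta_Z \<beta> n) / ennreal (beta_Z \<beta> n)"
    unfolding nn_integral_beta_ensemble[OF \<beta>0 F] by (rule divide_right_mono_ennreal)
  also have "\<dots> = ennreal (exp (real n + \<beta> * real n ^ 2))"
    using beta_Z_pos[OF \<beta>0, of n] by (simp add: ennreal_mult''[symmetric] divide_ennreal)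
  finally have mom: "(\<integral>\<^sup>+x. ennreal (exp (real n * \<beta> / 8 * S x)) \<partial>?P) \<le> ennreal (exp (real n + \<beta> * real n ^ 2))" .
  have "emeasure ?P ?E = (\<integral>\<^sup>+x. indicator ?E x \<partial>?P)"
    using E by simp
  also have "\<dots> \<le> (\<integral>\<^sup>+x. ennreal (exp (- (4 * \<beta> * real n ^ 3))) * ennreal (exp (real n * \<beta> / 8 * S x)) \<partial>?P)"
  proof (rule nn_integral_mono)
    fix x
    show "indicator ?E x \<le> ennreal (exp (- (4 * \<beta> * real n ^ 3))) * ennreal (exp (real n * \<beta> / 8 * S x))"
    proof (cases "x \<in> ?E")
      case True
      then have "real n * \<beta> / 8 * (32 * real n ^ 2) \<le> real n * \<beta> / 8 * S x"
        using \<beta>0 by (intro mult_left_mono) (auto simp: S_def)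
      then have "1 \<le> exp (- (4 * \<beta> * real n ^ 3)) * exp (real n * \<beta> / 8 * S x)"
        unfolding mult_exp_exp by (subst one_le_exp_iff) (simp add: power2_eq_square power3_eq_cube mult_ac)
      then show ?thesis
        using True by (subst ennreal_mult[symmetric]) (auto simp del: ennreal_1 simp flip: ennreal_1)
    qed simp
  qed
  also have "\<dots> = ennreal (exp (- (4 * \<beta> * real n ^ 3))) * (\<integral>\<^sup>+x. ennreal (exp (real n * \<beta> / 8 * S x)) \<partial>?P)"
    by (rule nn_integral_cmult) (use F in \<open>simp add: measurable_cong_sets[OF sets_beta_ensemble refl]\<close>)
  also have "\<dots> \<le> ennreal (exp (- (4 * \<beta> * real n ^ 3))) * ennreal (exp (real n + \<beta> * real n ^ 2))"
    by (intro mult_left_mono mom) simp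
  also have "\<dots> = ennreal (exp (- (4 * \<beta> * real n ^ 3) + (real n + \<beta> * real n ^ 2)))"
    by (simp only: exp_add ennreal_mult exp_ge_zero mult_nonneg_nonneg)
  also have "\<dots> \<le> ennreal (exp (- real n))"
  proof (intro ennreal_leI exp_le_cancel_iff[THEN iffD2])
    have n1: "1 \<le> real n" using n by simp
    have "real n ^ 2 \<le> real n ^ 3" "real n \<le> real n ^ 3"
      using n1 power_increasing[of 2 3 "real n"] power_increasing[of 1 3 "real n"] by simp_all
    then have "\<beta> * real n ^ 2 \<le> \<beta> * real n ^ 3" "1 * real n \<le> \<beta> * real n ^ 3"
      using \<beta> by (intro mult_mono; simp)+
    then show "- (4 * \<beta> * real n ^ 3) + (real n + \<beta> * real n ^ 2) \<le> - real n"
      by linarith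
  qed
  finally show ?thesis .
qed

section \<open>Bounds for the Lagrange polynomials\<close>

text \<open>Distinctness of the points is not assumed: if \<open>x j\<close> equals another point,
  both sides are 0 by y / 0 = 0.\<close>

lemma weighted_lagrange_eq_weighted_poly:
  "weighted_lagrange n x j = weighted_poly n
     (exp (real n / 4 * (x j)\<^sup>2) / (\<Prod>k\<in>{1..n} - {j}. x j - x k)) ({1..n} - {j}) x"
  unfolding weighted_lagrange_def weighted_poly_def
proof (rule ext)
  fix t
  have "exp (- (1 / 4) * real n * (t\<^sup>2 - (x j)\<^sup>2)) = exp (real n / 4 * (x j)\<^sup>2) * exp (- (real n / 4) * t\<^sup>2)"
    unfolding mult_exp_exp by (rule arg_cong[of _ _ exp]) (simp add: algebra_simps)
  then show "(\<Prod>k\<in>{1..n} - {j}. (t - x k) / (x j - x k)) * exp (- (1 / 4) * real n * (t\<^sup>2 - (x j)\<^sup>2))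
    = exp (real n / 4 * (x j)\<^sup>2) / (\<Prod>k\<in>{1..n} - {j}. x j - x k)
      * (\<Prod>k\<in>{1..n} - {j}. t - x k) * exp (- (real n / 4) * t\<^sup>2)"
    by (simp add: prod_dividef)
qed

text \<open>The growth of \<beta> enters here: n^(8 / \<beta>) = exp(8 ln n / \<beta>) \<le> exp(8 /
  c0). The hypothesis n \<ge> 2 gives 3 \<le> n^2, which absorbs the constant 3 into the power
  n^8.\<close>

lemma weighted_lagrange_le:
  assumes n: "n \<ge> 2" and c0: "c0 > 0" and \<beta>: "\<beta> > 0" "\<beta> \<ge> c0 * ln (real n)"
    and int: "(\<integral>\<^sup>+t. ennreal (\<bar>weighted_lagrange n x j t\<bar> powr \<beta>) \<partial>lborel) \<le> ennreal (real n ^ 4)"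
  shows "\<bar>weighted_lagrange n x j t\<bar> \<le> 16 * exp (8 / c0)"
proof -
  have "\<bar>weighted_lagrange n x j t\<bar> \<le> 16 * (3 * real n ^ 2 * real n ^ 4) powr (1 / \<beta>)"
    unfolding weighted_lagrange_eq_weighted_poly
  proof (rule weighted_poly_sup_le_integral)
    show "card ({1..n} - {j}) \<le> n"
      using card_mono[of "{1..n}" "{1..n} - {j}"] by auto
  qed (use n \<beta> int in \<open>auto simp: weighted_lagrange_eq_weighted_poly\<close>)
  also have "(3 * real n ^ 2 * real n ^ 4) powr (1 / \<beta>) \<le> (real n ^ 8) powr (1 / \<beta>)"
  proof (intro powr_mono2)
    have "3 \<le> real n ^ 2" using power_mono[of 2 "real n" 2] n by simp
    then have "3 * (real n ^ 2 * real n ^ 4) \<le> real n ^ 2 * (real n ^ 2 * real n ^ 4)"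
      by (intro mult_right_mono) auto
    then show "3 * real n ^ 2 * real n ^ 4 \<le> real n ^ 8"
      by (simp add: mult.assoc flip: power_add)
  qed (use \<beta> in auto)
  also have "(real n ^ 8) powr (1 / \<beta>) = exp (8 * ln (real n) / \<beta>)"
    using n by (simp add: powr_def ln_realpow)
  also have "\<dots> \<le> exp (8 / c0)"
    using \<beta> c0 by (simp add: field_simps)
  finally show ?thesis by simp
qed


text \<open>The threshold n^4 is set by summability: each \<open>j\<close> costs 12 n / n^4, and n
  of them cost 12 / n^2. The cutoff 6 n is large enough for the tail event, as 32 \<le> 36.\<close>

lemma beta_ensemble_bad_event:
  assumes \<beta>: "\<beta> \<ge> 1" and n: "n \<ge> 1"
  obtains B where "B \<in> sets (beta_ensemble \<beta> n)"
    and "measure (beta_ensemble \<beta> n) B \<le> exp (- real n) + 12 / real n ^ 2"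
    and "\<And>x j. x \<in> space (beta_ensemble \<beta> n) - B \<Longrightarrow> j \<in> {1..n} \<Longrightarrow>
       (\<integral>\<^sup>+t. ennreal (\<bar>weighted_lagrange n x j t\<bar> powr \<beta>) \<partial>lborel) \<le> ennreal (real n ^ 4)"
proof
  have \<beta>0: "\<beta> > 0" using \<beta> by simp
  interpret P: prob_space "beta_ensemble \<beta> n" by (rule prob_space_beta_ensemble[OF \<beta>0])
  define J where "J j x = (\<integral>\<^sup>+t. ennreal (\<bar>weighted_lagrange n x j t\<bar> powr \<beta>) \<partial>lborel)" for j x
  define T where "T = {x \<in> space (lebesgue_Rn n). 32 * real n ^ 2 \<le> (\<Sum>k\<in>{1..n}. (x k)\<^sup>2)}"
  define L where "L j = {x \<in> space (lebesgue_Rn n). x j \<in> {- (6 * real n)..6 * real n} \<and> ennreal (real n ^ 4) \<le> J j x}" for j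
  define B where "B = T \<union> (\<Union>j\<in>{1..n}. L j)"
  have T: "T \<in> sets (beta_ensemble \<beta> n)"
    unfolding T_def sets_beta_ensemble by measurable
  have L: "L j \<in> sets (beta_ensemble \<beta> n)" if "j \<in> {1..n}" for j
  proof -
    have [measurable]: "J j \<in> borel_measurable (lebesgue_Rn n)"
      using lagrange_integral_measurable[OF that, of \<beta>] unfolding J_def .
    have [measurable]: "(\<lambda>x. x j) \<in> borel_measurable (lebesgue_Rn n)"
      by (rule component_measurable_lebesgue_Rn[OF that])
    show ?thesis unfolding L_def sets_beta_ensemble by measurable
  qed
  show "B \<in> sets (beta_ensemble \<beta> n)"
    unfolding B_def using T L by (intro sets.Un sets.finite_UN) auto
  have mT: "measure (beta_ensemble \<beta> n) T \<le> exp (- real n)"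
    using emeasure_beta_ensemble_tail_le[OF \<beta> n] unfolding T_def[symmetric]
    by (simp add: P.emeasure_eq_measure)
  have mL: "measure (beta_ensemble \<beta> n) (L j) \<le> 12 / real n ^ 3" if "j \<in> {1..n}" for j
  proof -
    have "emeasure (beta_ensemble \<beta> n) (L j) \<le> ennreal (2 * (6 * real n) / real n ^ 4)"
      unfolding L_def J_def using n by (intro emeasure_beta_ensemble_lagrange_integral_le[OF that \<beta>0]) auto
    also have "2 * (6 * real n) / real n ^ 4 = 12 / real n ^ 3"
      using n by (simp add: field_simps power_numeral_reduce)
    finally show ?thesis by (simp add: P.emeasure_eq_measure)
  qed
  have "measure (beta_ensemble \<beta> n) B
      \<le> measure (beta_ensemble \<beta> n) T + measure (beta_ensemble \<beta> n) (\<Union>j\<in>{1..n}. L j)"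
    unfolding B_def using T L by (intro measure_Un_le sets.finite_UN) auto
  also have "measure (beta_ensemble \<beta> n) (\<Union>j\<in>{1..n}. L j) \<le> (\<Sum>j\<in>{1..n}. measure (beta_ensemble \<beta> n) (L j))"
    using L by (intro measure_UNION_le) auto
  also have "\<dots> \<le> (\<Sum>j\<in>{1..n}. 12 / real n ^ 3)"
    by (intro sum_mono mL)
  also have "\<dots> = 12 / real n ^ 2"
    using n by (simp add: field_simps power_numeral_reduce)
  finally show "measure (beta_ensemble \<beta> n) B \<le> exp (- real n) + 12 / real n ^ 2"
    using mT by linarith
  fix x j assume x: "x \<in> space (beta_ensemble \<beta> n) - B" and j: "j \<in> {1..n}"
  have "(x j)\<^sup>2 \<le> (\<Sum>k\<in>{1..n}. (x k)\<^sup>2)"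
    using j by (intro member_le_sum) auto
  also have "\<dots> < 32 * real n ^ 2" using x by (auto simp: B_def T_def)
  also have "\<dots> \<le> (6 * real n)\<^sup>2" by (simp add: power_mult_distrib)
  finally have "\<bar>x j\<bar> \<le> 6 * real n"
    using abs_le_square_iff[of "x j" "6 * real n"] by simp
  moreover have "x \<notin> L j" using x j by (auto simp: B_def)
  ultimately have "J j x \<le> ennreal (real n ^ 4)"
    using x by (auto simp: L_def)
  then show "(\<integral>\<^sup>+t. ennreal (\<bar>weighted_lagrange n x j t\<bar> powr \<beta>) \<partial>lborel) \<le> ennreal (real n ^ 4)"
    unfolding J_def .
qed

section \<open>Borel-Cantelli for the sequence of ensembles\<close>

lemma AE_limsup_lagrange_le:
  fixes \<beta> :: "nat \<Rightarrow> real"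
  assumes c0: "c0 > 0" and \<beta>: "\<And>n. \<beta> n > 0"
    and ev: "\<forall>\<^sub>F n in sequentially. \<beta> n \<ge> c0 * ln (real n)"
  shows "AE \<omega> in (\<Pi>\<^sub>M n\<in>{1..}. beta_ensemble (\<beta> n) n).
     limsup (\<lambda>n. Max ((\<lambda>j. sup_norm (weighted_lagrange n (\<omega> n) j)) ` {1..n})) \<le> ereal (16 * exp (8 / c0))"
proof -
  define M where "M n = beta_ensemble (\<beta> n) n" for n
  interpret product_prob_space M "{1..}"
    by (intro product_prob_spaceI) (simp add: M_def prob_space_beta_ensemble \<beta>)
  have "\<exists>B. B \<in> sets (M n) \<and> measure (M n) B \<le> exp (- real n) + 12 / real n ^ 2 \<and>
      (\<forall>x\<in>space (M n) - B. \<forall>j\<in>{1..n}.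
       (\<integral>\<^sup>+t. ennreal (\<bar>weighted_lagrange n x j t\<bar> powr \<beta> n) \<partial>lborel) \<le> ennreal (real n ^ 4))"
    if "1 \<le> n" "1 \<le> \<beta> n" for n
    unfolding M_def using beta_ensemble_bad_event[OF that(2,1)] by metis
  then obtain B where B: "\<And>n. 1 \<le> n \<Longrightarrow> 1 \<le> \<beta> n \<Longrightarrow> B n \<in> sets (M n) \<and>
      measure (M n) (B n) \<le> exp (- real n) + 12 / real n ^ 2 \<and>
      (\<forall>x\<in>space (M n) - B n. \<forall>j\<in>{1..n}.
       (\<integral>\<^sup>+t. ennreal (\<bar>weighted_lagrange n x j t\<bar> powr \<beta> n) \<partial>lborel) \<le> ennreal (real n ^ 4))"
    by metis
  \<comment> \<open>The bad sets are available only for \<beta> n \<ge> 1. Elsewhere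
    \<open>A n\<close> is empty, which keeps the probability bound valid for every
    \<open>n\<close>.\<close>
  define A where "A n = (if 1 \<le> n \<and> 1 \<le> \<beta> n then {\<omega> \<in> space (PiM {1..} M). \<omega> n \<in> B n} else {})" for n
  have A: "A n \<in> sets (PiM {1..} M)" for n
  proof (cases "1 \<le> n \<and> 1 \<le> \<beta> n")
    case True
    then have [measurable]: "B n \<in> sets (M n)" using B by auto
    have [measurable]: "(\<lambda>\<omega>. \<omega> n) \<in> measurable (PiM {1..} M) (M n)"
      using True by (intro measurable_component_singleton) auto
    have "{\<omega> \<in> space (PiM {1..} M). \<omega> n \<in> B n} \<in> sets (PiM {1..} M)" by measurable
    then show ?thesis using True by (simp add: A_def)
  qed (auto simp: A_def)
  have mA: "measure (PiM {1..} M) (A n) \<le> exp (- real n) + 12 / real n ^ 2" for n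
  proof (cases "1 \<le> n \<and> 1 \<le> \<beta> n")
    case True
    \<comment> \<open>The event constrains the \<open>n\<close>-th coordinate alone, so its
      probability is that of \<open>B n\<close> under the \<open>n\<close>-th marginal.\<close>
    then have "emeasure (PiM {1..} M) (A n) = emeasure (M n) (B n)"
      using B[of n] emeasure_PiM_Collect_single[of n "B n"] by (simp add: A_def)
    then show ?thesis using B[of n] True by (simp add: measure_def)
  qed (auto simp: A_def)
  have "summable (\<lambda>n. exp (- real n) + 12 / real n ^ 2)"
  proof (rule summable_add)
    have "summable (\<lambda>n. exp (-1 :: real) ^ n)"
      by (rule summable_geometric) simp
    then show "summable (\<lambda>n. exp (- real n))"
      by (simp flip: exp_of_nat_mult)
    show "summable (\<lambda>n. 12 / real n ^ 2)"
      using summable_mult[OF inverse_power_summable[of 2, where 'a = real], of 12]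
      by (simp add: divide_inverse)
  qed
  then have "summable (\<lambda>n. measure (PiM {1..} M) (A n))"
    by (rule summable_comparison_test'[where N = 0]) (use mA in simp)
  then have AE: "AE \<omega> in PiM {1..} M. \<forall>\<^sub>F n in sequentially. \<omega> \<in> space (PiM {1..} M) - A n"
  proof (intro borel_cantelli_AE1 A)
    show "emeasure (PiM {1..} M) (A n) < \<infinity>" for n
      using P.emeasure_finite[of "A n"] by (simp only: less_top infinity_ennreal_def)
  qed
  have "filterlim (\<lambda>n. c0 * ln (real n)) at_top sequentially"
    by (intro filterlim_tendsto_pos_mult_at_top[OF tendsto_const c0]
        filterlim_compose[OF ln_at_top filterlim_real_sequentially])
  then have "\<forall>\<^sub>F n in sequentially. 1 \<le> c0 * ln (real n)"
    by (simp add: filterlim_at_top)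
  \<comment> \<open>Since c0 ln n tends to infinity, \<beta> n \<ge> 1 holds from some index on, and
    beyond it \<open>A n\<close> is the genuine bad event.\<close>
  with ev have ev1: "\<forall>\<^sub>F n in sequentially. c0 * ln (real n) \<le> \<beta> n \<and> 1 \<le> \<beta> n \<and> 2 \<le> n"
    using eventually_ge_at_top[of 2] by eventually_elim auto
  show ?thesis
    unfolding M_def[symmetric] using AE
  proof eventually_elim
    case (elim \<omega>)
    show ?case
    proof (rule Limsup_bounded)
      show "\<forall>\<^sub>F n in sequentially. Max ((\<lambda>j. sup_norm (weighted_lagrange n (\<omega> n) j)) ` {1..n})
          \<le> ereal (16 * exp (8 / c0))"
        using elim ev1
      proof eventually_elim
        case (elim n)
        then have "\<omega> n \<in> space (M n) - B n" by (auto simp: A_def space_PiM PiE_iff)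
        then have "(\<integral>\<^sup>+t. ennreal (\<bar>weighted_lagrange n (\<omega> n) j t\<bar> powr \<beta> n) \<partial>lborel) \<le> ennreal (real n ^ 4)"
          if "j \<in> {1..n}" for j
          using B[of n] elim that by auto
        then have "\<bar>weighted_lagrange n (\<omega> n) j t\<bar> \<le> 16 * exp (8 / c0)" if "j \<in> {1..n}" for j t
          using elim that by (intro weighted_lagrange_le[OF _ c0 \<beta>]) auto
        then have "sup_norm (weighted_lagrange n (\<omega> n) j) \<le> ereal (16 * exp (8 / c0))" if "j \<in> {1..n}" for j
          unfolding sup_norm_def using that by (intro SUP_least) auto
        then show ?case using elim by (intro Max.boundedI) auto
      qed
    qed
  qed
qed

theorem theorem1p9:
  fixes c0 :: real
  assumes "c0 > 0"
  shows "\<exists>C::real. C \<ge> 1 \<and>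
    (\<forall>\<beta> :: nat \<Rightarrow> real.
       (\<forall>n\<ge>1. \<beta> n > 0) \<longrightarrow>
       (\<forall>\<^sub>F n in sequentially. \<beta> n \<ge> c0 * ln (real n)) \<longrightarrow>
       (AE \<omega> in (\<Pi>\<^sub>M n\<in>{1..}. beta_ensemble (\<beta> n) n).
          limsup (\<lambda>n. Max ((\<lambda>j. sup_norm (weighted_lagrange n (\<omega> n) j)) ` {1..n})) \<le> ereal C))"
proof (intro exI conjI allI impI)
  have "1 \<le> exp (8 / c0)" using assms by simp
  then show "1 \<le> 16 * exp (8 / c0)" by linarith
  fix \<beta> :: "nat \<Rightarrow> real"
  assume \<beta>: "\<forall>n\<ge>1. \<beta> n > 0" "\<forall>\<^sub>F n in sequentially. \<beta> n \<ge> c0 * ln (real n)"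
  \<comment> \<open>The auxiliary lemma asks for a probability space at every natural index,
    including 0, where \<open>\<beta>\<close> is unconstrained. Index 0 lies outside the product, so
    the change does not affect the measure.\<close>
  define \<beta>' where "\<beta>' = \<beta>(0 := 1)"
  have "\<forall>\<^sub>F n in sequentially. \<beta>' n \<ge> c0 * ln (real n)"
    using \<beta>(2) eventually_ge_at_top[of 1] by eventually_elim (simp add: \<beta>'_def)
  then have "AE \<omega> in (\<Pi>\<^sub>M n\<in>{1..}. beta_ensemble (\<beta>' n) n).
     limsup (\<lambda>n. Max ((\<lambda>j. sup_norm (weighted_lagrange n (\<omega> n) j)) ` {1..n})) \<le> ereal (16 * exp (8 / c0))"
    using \<beta>(1) by (intro AE_limsup_lagrange_le[OF assms]) (auto simp: \<beta>'_def)
  also have "(\<Pi>\<^sub>M n\<in>{1..}. beta_ensemble (\<beta>' n) n) = (\<Pi>\<^sub>M n\<in>{1..}. beta_ensemble (\<beta> n) n)"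
    by (intro PiM_cong) (auto simp: \<beta>'_def)
  finally show "AE \<omega> in (\<Pi>\<^sub>M n\<in>{1..}. beta_ensemble (\<beta> n) n).
     limsup (\<lambda>n. Max ((\<lambda>j. sup_norm (weighted_lagrange n (\<omega> n) j)) ` {1..n})) \<le> ereal (16 * exp (8 / c0))" .
qed

end
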